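(* Consider the opinion dynamics on $\mathbb{R}^{N_a}$ $$\dot x_i = -d\,x_i + u\,S\Big(\alpha x_i + \gamma \sum_{k=1,\,k\neq i}^{N_a} \bar a_{ik} x_k\Big),\qquad i=1,\dots,N_a,$$ with parameters $d>0$, $\alpha\ge 0$, $\gamma\in\mathbb{R}$, a common attention parameter $u\ge 0$, zero inputs, and $\bar A=(\bar a_{ik})$ the $0/1$ adjacency matrix of a graph $\bar G$ with vertex set $V=\{1,\dots,N_a\}$. Let $\lambda_{max}$ and $\lambda_{min}$ be the eigenvalues of $\bar A$ with largest and smallest real parts, and let $W(\lambda)$ be the generalized eigenspace of $\bar A$ for the eigenvalue $\lambda$. **A (cooperation leads to agreement).** Let $\bar G$ be a strongly connected directed graph. If $\gamma>0$, then the neutral state $\mathbf{x}=\mathbf{0}$ is a locally exponentially stable equilibrium for $0<u<u_a$ and unstable for $u>u_a$, where $$u_a=\frac{d}{\alpha+\gamma\lambda_{max}}.$$ At $u=u_a$, branches of agreement equilibria, i.e. equilibria with $x_i\neq 0$ and $\operatorname{sign}(x_i)=\operatorname{sign}(x_k)$ for all $i,k\in V$, emerge in a steady-state bifurcation off of $\mathbf{x}=\mathbf{0}$ along $W(\lambda_{max})$. **B (competition leads to disagreement).** Let $\bar G$ be a connected undirected graph. If $\gamma<0$, then the neutral state $\mathbf{x}=\mathbf{0}$ is a locally exponentially stable equilibrium for $0<u<u_d$ and unstable for $u>u_d$, where $$u_d=\frac{d}{\alpha+\gamma\lambda_{min}}.$$ At $u=u_d$, branches of disagreement equilibria, i.e.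 equilibria with $\operatorname{sign}(x_i)=-\operatorname{sign}(x_k)\neq 0$ for at least one pair $i,k\in V$, $i\neq k$, emerge in a steady-state bifurcation off of $\mathbf{x}=\mathbf{0}$ along $W(\lambda_{min})$.
   Context: Standing assumptions: $N_a\ge 2$; the graph has no self-loops ($\bar a_{ii}=0$); $\bar a_{ik}\in\{0,1\}$ with $\bar a_{ik}=1$ iff $(i,k)$ is an edge; for an undirected graph $\bar A$ is symmetric. $S:\mathbb{R}\to\mathbb{R}$ is an odd, saturating (bounded), twice continuously differentiable function with $S(0)=0$, $S'(0)=1$, and $\operatorname{sign}(S''(z))=-\operatorname{sign}(z)$ for all $z$. Bifurcation terminology: "branches of equilibria emerge in a steady-state bifurcation off of $\mathbf{x}=\mathbf{0}$ at $u=u^*$ along a subspace $W$" means that the Jacobian of the vector field at $\mathbf{x}=\mathbf{0}$, $u=u^*$ has kernel $W\neq\{0\}$, and that there are equilibria $(\mathbf{x},u)$ with $\mathbf{x}\neq\mathbf{0}$ arbitrarily close to $(\mathbf{0},u^* )$, with the directions $\mathbf{x}/\|\mathbf{x}\|$ accumulating only on $W$ as $(\mathbf{x},u)\to(\mathbf{0},u^* )$. Sign properties asserted for equilibria on the branches are local: they hold for the nonzero equilibria on the branches that are sufficiently close to $(\mathbf{0},u^* )$. *)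

theory Defs
  imports "HOL-Analysis.Analysis"
begin

text \<open>Graphs on the vertex set \<open>UNIV :: 'n set\<close> are edge relations; an undirected graph is a
  symmetric one.\<close>

definition adjacency_matrix :: "('n \<times> 'n) set \<Rightarrow> real ^ 'n ^ 'n" where
  "adjacency_matrix E = (\<chi> i k. if (i, k) \<in> E then 1 else 0)"

definition strongly_connected_graph :: "('n \<times> 'n) set \<Rightarrow> bool" where
  "strongly_connected_graph E \<longleftrightarrow> (\<forall>i k. (i, k) \<in> E\<^sup>*)"

definition connected_undirected_graph :: "('n \<times> 'n) set \<Rightarrow> bool" where
  "connected_undirected_graph E \<longleftrightarrow> sym E \<and> (\<forall>i k. (i, k) \<in> E\<^sup>*)"

definition complex_eigenvalue :: "real ^ 'n ^ 'n \<Rightarrow> complex \<Rightarrow> bool" where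
  "complex_eigenvalue A l \<longleftrightarrow>
    (\<exists>v :: complex ^ 'n. v \<noteq> 0 \<and> map_matrix complex_of_real A *v v = l *s v)"

definition eigenvalue_max_Re :: "real ^ 'n ^ 'n \<Rightarrow> complex \<Rightarrow> bool" where
  "eigenvalue_max_Re A l \<longleftrightarrow>
    complex_eigenvalue A l \<and> (\<forall>m. complex_eigenvalue A m \<longrightarrow> Re m \<le> Re l)"

definition eigenvalue_min_Re :: "real ^ 'n ^ 'n \<Rightarrow> complex \<Rightarrow> bool" where
  "eigenvalue_min_Re A l \<longleftrightarrow>
    complex_eigenvalue A l \<and> (\<forall>m. complex_eigenvalue A m \<longrightarrow> Re l \<le> Re m)"

definition generalized_eigenspace :: "real ^ 'n ^ 'n \<Rightarrow> real \<Rightarrow> (real ^ 'n) set" where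
  "generalized_eigenspace A l = {v. \<exists>k. ((\<lambda>w. (A - mat l) *v w) ^^ k) v = 0}"

definition saturation :: "(real \<Rightarrow> real) \<Rightarrow> bool" where
  "saturation S \<longleftrightarrow>
    (\<forall>z. S (- z) = - S z) \<and> bounded (range S) \<and> S 0 = 0 \<and>
    (\<exists>S' S''.
      (\<forall>z. (S has_real_derivative S' z) (at z)) \<and>
      (\<forall>z. (S' has_real_derivative S'' z) (at z)) \<and>
      continuous_on UNIV S'' \<and>
      S' 0 = 1 \<and> (\<forall>z. sgn (S'' z) = - sgn z))"

definition opinion_field ::
  "(real \<Rightarrow> real) \<Rightarrow> real \<Rightarrow> real \<Rightarrow> real \<Rightarrow> real ^ 'n ^ 'n \<Rightarrow> real \<Rightarrow> real ^ 'n \<Rightarrow> real ^ 'n" where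
  "opinion_field S d \<alpha> \<gamma> A u x =
    (\<chi> i. - d * x $ i + u * S (\<alpha> * x $ i + \<gamma> * (\<Sum>k\<in>UNIV - {i}. A $ i $ k * x $ k)))"

definition agreement :: "real ^ 'n \<Rightarrow> bool" where
  "agreement x \<longleftrightarrow> (\<forall>i k. x $ i \<noteq> 0 \<and> sgn (x $ i) = sgn (x $ k))"

definition disagreement :: "real ^ 'n \<Rightarrow> bool" where
  "disagreement x \<longleftrightarrow> (\<exists>i k. i \<noteq> k \<and> sgn (x $ i) = - sgn (x $ k) \<and> sgn (x $ k) \<noteq> 0)"

definition solution_on :: "('a::real_normed_vector \<Rightarrow> 'a) \<Rightarrow> real \<Rightarrow> (real \<Rightarrow> 'a) \<Rightarrow> bool" where
  "solution_on f T x \<longleftrightarrow>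
    (\<forall>t\<in>{0..T}. (x has_vector_derivative f (x t)) (at t within {0..T}))"

text \<open>The stability notions quantify over solutions on all compact intervals \<open>{0..T}\<close>, so that
  they do not presuppose that solutions exist for all time.\<close>

definition locally_exponentially_stable :: "('a::real_normed_vector \<Rightarrow> 'a) \<Rightarrow> 'a \<Rightarrow> bool" where
  "locally_exponentially_stable f p \<longleftrightarrow>
    f p = 0 \<and>
    (\<exists>\<delta>>0. \<exists>M>0. \<exists>r>0. \<forall>T x. solution_on f T x \<and> dist (x 0) p < \<delta> \<longrightarrow>
      (\<forall>t\<in>{0..T}. dist (x t) p \<le> M * exp (- r * t) * dist (x 0) p))"

definition lyapunov_stable :: "('a::real_normed_vector \<Rightarrow> 'a) \<Rightarrow> 'a \<Rightarrow> bool" where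
  "lyapunov_stable f p \<longleftrightarrow>
    f p = 0 \<and>
    (\<forall>\<epsilon>>0. \<exists>\<delta>>0. \<forall>T x. solution_on f T x \<and> dist (x 0) p < \<delta> \<longrightarrow>
      (\<forall>t\<in>{0..T}. dist (x t) p < \<epsilon>))"

definition unstable_equilibrium :: "('a::real_normed_vector \<Rightarrow> 'a) \<Rightarrow> 'a \<Rightarrow> bool" where
  "unstable_equilibrium f p \<longleftrightarrow> f p = 0 \<and> \<not> lyapunov_stable f p"

definition nonzero_equilibria ::
  "real set \<Rightarrow> (real \<Rightarrow> 'a::real_normed_vector \<Rightarrow> 'a) \<Rightarrow> ('a \<times> real) set" where
  "nonzero_equilibria U f = {(x, u). u \<in> U \<and> x \<noteq> 0 \<and> f u x = 0}"

text \<open>Every accumulation point of the directions is the limit along some sequence of nonzero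
  equilibria, hence the sequential formulation in the last conjunct.\<close>

definition steady_state_bifurcation ::
  "real set \<Rightarrow> (real \<Rightarrow> 'a::real_normed_vector \<Rightarrow> 'a) \<Rightarrow> real \<Rightarrow> 'a set \<Rightarrow> bool" where
  "steady_state_bifurcation U f u\<^sub>0 W \<longleftrightarrow>
    W \<noteq> {0} \<and>
    (\<exists>J. (f u\<^sub>0 has_derivative J) (at 0) \<and> {v. J v = 0} = W) \<and>
    (\<forall>\<epsilon>>0. \<exists>q\<in>nonzero_equilibria U f. dist q (0, u\<^sub>0) < \<epsilon>) \<and>
    (\<forall>q l. (\<forall>n::nat. q n \<in> nonzero_equilibria U f) \<and> q \<longlonglongrightarrow> (0, u\<^sub>0) \<and>
      (\<lambda>n. fst (q n) /\<^sub>R norm (fst (q n))) \<longlonglongrightarrow> l \<longrightarrow> l \<in> W)"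

text \<open>\<open>P\<close> is the (local) property of the equilibria on the emerging branches, e.g. agreement.\<close>

definition branches_emerge ::
  "real set \<Rightarrow> (real \<Rightarrow> 'a::real_normed_vector \<Rightarrow> 'a) \<Rightarrow> ('a \<Rightarrow> bool) \<Rightarrow> real \<Rightarrow> 'a set \<Rightarrow> bool" where
  "branches_emerge U f P u\<^sub>0 W \<longleftrightarrow>
    steady_state_bifurcation U f u\<^sub>0 W \<and>
    (\<exists>\<epsilon>>0. \<forall>(x, u)\<in>nonzero_equilibria U f. dist (x, u) (0, u\<^sub>0) < \<epsilon> \<longrightarrow> P x)"

end

theory Submission
  imports Defs
begin

text \<open>
  Write the field as \<open>F u x = u S(B x) - d x\<close> with \<open>B = \<alpha> + \<gamma> A\<close>, and let \<open>\<mu> = \<alpha> + \<gamma> \<lambda>\<close> be the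
  leading eigenvalue of \<open>B\<close>, so that the critical attention is \<open>d / \<mu>\<close>.

  Cooperation: \<open>B\<close> is nonnegative, with positive right and left Perron vectors \<open>v\<close>, \<open>w\<close>. By AM-GM the
  form \<open>\<Sum>\<^sub>i (w\<^sub>i / v\<^sub>i) x\<^sub>i\<^sup>2\<close> decays along solutions if \<open>u \<mu> < d\<close>; if \<open>u \<mu> > d\<close>, then \<open>w \<bullet> x\<close> grows
  along small positive solutions. For \<open>u\<close> slightly above \<open>d / \<mu>\<close> the monotone map \<open>x \<mapsto> (u / d) S(B x)\<close>
  preserves a box between two small multiples of \<open>v\<close>, and Brouwer's theorem gives an equilibrium.

  Competition: \<open>B\<close> is symmetric and \<open>\<mu>\<close> is the maximum of its Rayleigh quotient, so \<open>x \<bullet> x\<close> decays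
  near \<open>0\<close> if \<open>u \<mu> < d\<close>. If \<open>u \<mu> > d\<close>, the indefinite form \<open>x \<bullet> (B - l) x\<close> grows for any \<open>l\<close>
  strictly between \<open>d / u\<close> and \<open>\<mu>\<close> that is not an eigenvalue. Equilibria are found variationally,
  since \<open>\<mu>\<close> may be a multiple eigenvalue.

  In both cases the normalized equilibria accumulate only on the kernel of the linearization, whose
  nonzero vectors have the asserted (open) sign pattern.
\<close>

section \<open>Saturating functions\<close>

text \<open>\<open>S'\<close> is even because \<open>S\<close> is odd, and the sign of
  \<open>S''\<close> makes it strictly decreasing on the nonnegative reals, so it is largest at
  \<open>0\<close>. It cannot become nonpositive: from there on \<open>S\<close> would fall at a
  linear rate, against boundedness.\<close>

lemma saturation_derivative:
  assumes "saturation S"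
  obtains S' where "\<And>z. (S has_real_derivative S' z) (at z)" "continuous_on UNIV S'"
    "S' 0 = 1" "\<And>z. 0 < S' z" "\<And>z. S' z \<le> 1" "\<And>z. z \<noteq> 0 \<Longrightarrow> S' z < 1"
proof -
  obtain S' S'' where odd: "\<And>z. S (- z) = - S z" and bdd: "bounded (range S)"
    and d1: "\<And>z. (S has_real_derivative S' z) (at z)"
    and d2: "\<And>z. (S' has_real_derivative S'' z) (at z)"
    and one: "S' 0 = 1" and sg: "\<And>z. sgn (S'' z) = - sgn z"
    using assms unfolding saturation_def by blast
  have even: "S' (- z) = S' z" for z
  proof -
    have "((\<lambda>z. - S (- z)) has_real_derivative S' (- z)) (at z)"
      by (auto intro!: derivative_eq_intros DERIV_chain2[OF d1])
    then show ?thesis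
      using d1[of z] odd by (simp add: DERIV_unique)
  qed
  have neg: "S'' z < 0" if "z > 0" for z
    using sg[of z] that by (simp add: sgn_if split: if_splits)
  have dec: "S' b < S' a" if "0 \<le> a" "a < b" for a b
  proof (rule DERIV_neg_imp_decreasing_open[OF \<open>a < b\<close>])
    show "\<exists>y. (S' has_real_derivative y) (at x) \<and> y < 0" if "a < x" "x < b" for x
      using d2[of x] neg[of x] that \<open>0 \<le> a\<close> by auto
    show "continuous_on {a..b} S'"
      using d2 by (meson DERIV_isCont continuous_at_imp_continuous_on)
  qed
  have pos: "0 < S' z" if "0 \<le> z" for z
  proof (rule ccontr)
    assume "\<not> 0 < S' z"
    \<comment> \<open>\<open>S' z\<close> may be exactly \<open>0\<close>; moving one unit to the
      right makes the slope strictly negative.\<close>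
    then have c: "S' (z + 1) < 0" using dec[of z "z + 1"] that by simp
    define c where "c = - S' (z + 1)"
    obtain K where K: "\<And>y. \<bar>S y\<bar> \<le> K"
      using bdd by (auto simp: bounded_iff)
    \<comment> \<open>Beyond \<open>z + 1\<close> the slope is below \<open>- c\<close>, so over the
      length \<open>(2 * K + 1) / c\<close> the value drops by at least \<open>2 * K + 1\<close>,
      more than the bound \<open>K\<close> on \<open>\<bar>S y\<bar>\<close> permits.\<close>
    define y where "y = z + 1 + (2 * K + 1) / c"
    have cpos: "c > 0" using c by (simp add: c_def)
    have K0: "K \<ge> 0" using K[of 0] by linarith
    then have yz: "z + 1 < y" using cpos by (simp add: y_def)
    obtain x where x: "z + 1 < x" "x < y" "S y - S (z + 1) = (y - (z + 1)) * S' x"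
      using MVT2[OF yz, of S S'] d1 by blast
    have "S' x < - c" using dec[of "z + 1" x] x that by (simp add: c_def)
    then have "(y - (z + 1)) * S' x \<le> (y - (z + 1)) * (- c)"
      using yz by (intro mult_left_mono) auto
    also have "\<dots> = - (2 * K + 1)" using cpos by (simp add: y_def)
    finally show False using x K[of y] K[of "z + 1"] by linarith
  qed
  have posall: "0 < S' z" for z
    using pos[of z] pos[of "- z"] even[of z] by (cases "0 \<le> z") auto
  have lt: "S' z < 1" if "z \<noteq> 0" for z
    using dec[of 0 "\<bar>z\<bar>"] even[of z] one that by (cases "0 \<le> z") auto
  show thesis
  proof (rule that[OF d1 _ one posall _ lt])
    show "continuous_on UNIV S'"
      using d2 by (meson DERIV_isCont continuous_at_imp_continuous_on)
    show "S' z \<le> 1" for z using lt[of z] one by (cases "z = 0") auto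
  qed
qed

lemma saturation_minus: "saturation S \<Longrightarrow> S (- z) = - S z"
  by (simp add: saturation_def)

lemma saturation_zero: "saturation S \<Longrightarrow> S 0 = 0"
  by (simp add: saturation_def)

lemma saturation_strict_mono:
  assumes "saturation S" "a < b"
  shows "S a < S b"
proof -
  obtain S' where "\<And>z. (S has_real_derivative S' z) (at z)" "\<And>z. 0 < S' z"
    using saturation_derivative[OF assms(1)] by metis
  then show ?thesis using DERIV_pos_imp_increasing[OF \<open>a < b\<close>, of S] by blast
qed

lemma saturation_mono:
  assumes "saturation S" "a \<le> b"
  shows "S a \<le> S b"
  using saturation_strict_mono[OF assms(1), of a b] assms(2) by (cases "a = b") auto

lemma saturation_nonneg: "saturation S \<Longrightarrow> 0 \<le> z \<Longrightarrow> 0 \<le> S z"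
  using saturation_mono[of S 0 z] saturation_zero[of S] by simp

lemma saturation_lipschitz:
  assumes "saturation S"
  shows "\<bar>S a - S b\<bar> \<le> \<bar>a - b\<bar>"
proof -
  obtain S' where S': "\<And>z. (S has_real_derivative S' z) (at z)" "\<And>z. 0 < S' z" "\<And>z. S' z \<le> 1"
    using saturation_derivative[OF assms(1)] by metis
  have "norm (S a - S b) \<le> 1 * norm (a - b)"
    by (rule field_differentiable_bound[of UNIV S S'])
      (use S' in \<open>auto simp: abs_le_iff less_imp_le intro: order_trans[of _ 0]
        dest: has_field_derivative_at_within\<close>)
  then show ?thesis by simp
qed

lemma saturation_abs_le:
  assumes "saturation S"
  shows "\<bar>S z\<bar> \<le> \<bar>z\<bar>"
  using saturation_lipschitz[OF assms, of z 0] saturation_zero[OF assms] by simp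

text \<open>The mean value theorem with \<open>S' < 1\<close> away from \<open>0\<close>. Strictness
  places the cooperative equilibria at attentions above the critical one and makes the potential
  inequality further below strict.\<close>

lemma saturation_less:
  assumes "saturation S" "0 < z"
  shows "S z < z"
proof -
  obtain S' where S': "\<And>z. (S has_real_derivative S' z) (at z)" "\<And>z. z \<noteq> 0 \<Longrightarrow> S' z < 1"
    using saturation_derivative[OF assms(1)] by metis
  obtain x where "0 < x" "S z - S 0 = (z - 0) * S' x"
    using MVT2[OF assms(2), of S S'] S' by blast
  then show ?thesis
    using S'(2)[of x] assms(2) saturation_zero[OF assms(1)] by simp
qed

lemma saturation_continuous: "saturation S \<Longrightarrow> continuous_on T S"
  by (rule saturation_derivative) (auto intro: DERIV_isCont continuous_at_imp_continuous_on)

lemma saturation_near_identity: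
  assumes "saturation S" "0 < e"
  obtains \<delta> where "0 < \<delta>" "\<And>z. \<bar>z\<bar> < \<delta> \<Longrightarrow> \<bar>S z - z\<bar> \<le> e * \<bar>z\<bar>"
proof -
  obtain S' where "\<And>z. (S has_real_derivative S' z) (at z)" "S' 0 = 1"
    using saturation_derivative[OF assms(1)] by metis
  then have "(S has_derivative (\<lambda>h. h)) (at 0)"
    by (metis has_field_derivative_def mult_1 ext)
  then obtain \<delta> where "0 < \<delta>"
    "\<And>z. norm (z - 0) < \<delta> \<Longrightarrow> norm (S z - S 0 - (z - 0)) \<le> e * norm (z - 0)"
    using assms(2) unfolding has_derivative_at_alt by blast
  then show thesis
    using saturation_zero[OF assms(1)] by (intro that[of \<delta>]) auto
qed

section \<open>Differential equations\<close>

text \<open>Disproving Lyapunov stability requires an actual solution that leaves a neighbourhood,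
  on an interval as long as the growth estimate asks for. A global Lipschitz bound supplies one for
  every \<open>T\<close>.\<close>

lemma solution_exists_if_lipschitz:
  fixes f :: "'a::banach \<Rightarrow> 'a"
  assumes lip: "L-lipschitz_on UNIV f" and "0 \<le> T"
  obtains x where "solution_on f T x" "x 0 = x0"
proof -
  \<comment> \<open>In the norm weighted by \<open>exp (- K t)\<close> the Picard operator contracts on all of \<open>{0..T}\<close>.\<close>
  define K where "K = L + 1"
  have L0: "0 \<le> L" using lip by (rule lipschitz_on_nonneg)
  have K: "0 < K" "L < K" using L0 by (auto simp: K_def)
  \<comment> \<open>The unknown \<open>\<phi>\<close> stands for the solution times
    \<open>exp (- K * t)\<close>: \<open>g\<close> undoes the weight before applying
    \<open>f\<close>, and \<open>I\<close> is the Picard integral with the weight put back.\<close>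
  define g where "g \<phi> s = f (exp (K * s) *\<^sub>R apply_bcontfun \<phi> s)" for \<phi> :: "real \<Rightarrow>\<^sub>C 'a" and s
  define I where "I \<phi> t = exp (- K * t) *\<^sub>R (x0 + integral {0..t} (g \<phi>))" for \<phi> t
  \<comment> \<open>Clamping the time to \<open>{0..T}\<close> turns the iterate into a bounded
    continuous function on all reals, an element of the complete space in which the fixed point is
    sought.\<close>
  define cl where "cl t = max 0 (min T t)" for t :: real
  have cl: "cl t \<in> {0..T}" for t using \<open>0 \<le> T\<close> by (auto simp: cl_def)
  have contf: "continuous_on A f" for A
    using lip by (meson lipschitz_on_continuous_on lipschitz_on_subset subset_UNIV)
  have contg: "continuous_on A (g \<phi>)" for A \<phi>
    unfolding g_def by (intro continuous_on_compose2[OF contf[of UNIV]] continuous_intros) auto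
  have intg: "g \<phi> integrable_on {0..t}" for \<phi> t
    by (intro integrable_continuous_real contg)
  have contI: "continuous_on {0..T} (I \<phi>)" for \<phi>
    unfolding I_def
    by (intro continuous_intros indefinite_integral_continuous_1 intg)
  define P where "P \<phi> = Bcontfun (\<lambda>t. I \<phi> (cl t))" for \<phi>
  have mem: "(\<lambda>t. I \<phi> (cl t)) \<in> bcontfun" for \<phi>
  proof -
    have "continuous_on UNIV (\<lambda>t. I \<phi> (cl t))"
      by (rule continuous_on_compose2[OF contI]) (use cl in \<open>auto simp: cl_def intro!: continuous_intros\<close>)
    moreover have "bounded (range (\<lambda>t. I \<phi> (cl t)))"
    proof (rule bounded_subset)
      show "bounded (I \<phi> ` {0..T})"
        by (intro compact_imp_bounded compact_continuous_image contI) auto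
    qed (use cl in auto)
    ultimately show ?thesis by (simp add: bcontfun_def)
  qed
  have P: "apply_bcontfun (P \<phi>) t = I \<phi> (cl t)" for \<phi> t
    unfolding P_def by (simp add: Bcontfun_inverse mem)
  have contr: "dist (P \<phi>) (P \<psi>) \<le> (L / K) * dist \<phi> \<psi>" for \<phi> \<psi>
  proof (rule dist_bound)
    fix t
    define s where "s = cl t"
    define D where "D = dist \<phi> \<psi>"
    have s: "0 \<le> s" using cl[of t] by (simp add: s_def)
    have hi: "((\<lambda>r. L * D * exp (K * r)) has_integral
        (L * D * exp (K * s) / K - L * D * exp (K * 0) / K)) {0..s}"
      by (rule fundamental_theorem_of_calculus[OF s])
        (use K in \<open>auto intro!: derivative_eq_intros simp flip: has_real_derivative_iff_has_vector_derivative\<close>)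
    have "norm (integral {0..s} (\<lambda>r. g \<phi> r - g \<psi> r)) \<le> integral {0..s} (\<lambda>r. L * D * exp (K * r))"
    proof (rule integral_norm_bound_integral)
      show "(\<lambda>r. g \<phi> r - g \<psi> r) integrable_on {0..s}" by (intro integrable_diff intg)
      show "(\<lambda>r. L * D * exp (K * r)) integrable_on {0..s}" using hi by blast
      fix r assume "r \<in> {0..s}"
      have "norm (g \<phi> r - g \<psi> r) \<le> L * dist (exp (K * r) *\<^sub>R apply_bcontfun \<phi> r) (exp (K * r) *\<^sub>R apply_bcontfun \<psi> r)"
        unfolding g_def dist_norm[symmetric] by (rule lipschitz_onD[OF lip]) auto
      also have "\<dots> = L * (exp (K * r) * dist (apply_bcontfun \<phi> r) (apply_bcontfun \<psi> r))"
        by (simp add: dist_norm flip: scaleR_diff_right)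
      also have "\<dots> \<le> L * (exp (K * r) * D)"
        using L0 by (intro mult_left_mono) (auto simp: D_def dist_bounded)
      finally show "norm (g \<phi> r - g \<psi> r) \<le> L * D * exp (K * r)" by (simp add: mult_ac)
    qed
    also have "\<dots> = L * D / K * (exp (K * s) - 1)"
      using integral_unique[OF hi] by (simp add: field_simps diff_divide_distrib)
    also have "\<dots> \<le> L * D / K * exp (K * s)"
      using L0 K by (intro mult_left_mono) (auto simp: D_def)
    finally have *: "norm (integral {0..s} (g \<phi>) - integral {0..s} (g \<psi>)) \<le> L * D / K * exp (K * s)"
      by (simp add: integral_diff intg)
    have "dist (apply_bcontfun (P \<phi>) t) (apply_bcontfun (P \<psi>) t)
        = exp (- K * s) * norm (integral {0..s} (g \<phi>) - integral {0..s} (g \<psi>))"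
      by (simp add: P I_def s_def dist_norm flip: scaleR_diff_right)
    also have "\<dots> \<le> exp (- K * s) * (L * D / K * exp (K * s))"
      by (intro mult_left_mono *) auto
    also have "\<dots> = L / K * D"
      by (simp add: exp_minus field_simps)
    finally show "dist (apply_bcontfun (P \<phi>) t) (apply_bcontfun (P \<psi>) t) \<le> L / K * dist \<phi> \<psi>"
      by (simp add: D_def)
  qed
  have "\<exists>!\<phi>. P \<phi> = \<phi>"
    by (rule banach_fix_type[of "L / K"]) (use L0 K contr in auto)
  then obtain \<phi> where fixp: "P \<phi> = \<phi>" by blast
  define x where "x t = x0 + integral {0..t} (g \<phi>)" for t
  have x_eq: "exp (K * t) *\<^sub>R apply_bcontfun \<phi> t = x t" if "t \<in> {0..T}" for t
  proof -
    have "cl t = t" using that by (auto simp: cl_def)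
    then have "apply_bcontfun \<phi> t = exp (- K * t) *\<^sub>R x t"
      using P[of \<phi> t] fixp by (simp add: I_def x_def)
    then show ?thesis by (simp flip: exp_add)
  qed
  have "solution_on f T x"
    unfolding solution_on_def
  proof
    fix t assume t: "t \<in> {0..T}"
    have "((\<lambda>t. integral {0..t} (g \<phi>)) has_vector_derivative g \<phi> t) (at t within {0..T})"
      by (rule integral_has_vector_derivative[OF contg t])
    then have "(x has_vector_derivative g \<phi> t) (at t within {0..T})"
      unfolding x_def by (auto intro!: derivative_eq_intros)
    then show "(x has_vector_derivative f (x t)) (at t within {0..T})"
      by (simp add: g_def x_eq[OF t])
  qed
  moreover have "x 0 = x0" by (simp add: x_def)
  ultimately show thesis by (rule that)
qed

text \<open>\<open>g t * exp (- c * t)\<close> has derivative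
  \<open>(g' t - c * g t) * exp (- c * t)\<close>, hence is nondecreasing. Below, a negative rate
  gives positivity of solutions and a positive one gives growth.\<close>

lemma exponential_lower_bound:
  fixes g :: "real \<Rightarrow> real"
  assumes der: "\<And>t. t \<in> {0..T} \<Longrightarrow> (g has_real_derivative g' t) (at t within {0..T})"
    and ge: "\<And>t. t \<in> {0..T} \<Longrightarrow> c * g t \<le> g' t" and "0 \<le> T"
  shows "g 0 * exp (c * T) \<le> g T"
proof -
  define h where "h t = g t * exp (- c * t)" for t
  have hder: "(h has_real_derivative (g' t - c * g t) * exp (- c * t)) (at t within {0..T})"
    if "t \<in> {0..T}" for t
    unfolding h_def
    by (auto intro!: derivative_eq_intros der[OF that] simp: algebra_simps)
  have "h 0 \<le> h T"
  proof (rule DERIV_nonneg_imp_increasing_open[OF \<open>0 \<le> T\<close>])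
    fix t assume t: "0 < t" "t < T"
    then have "at t within {0..T} = at t" by (simp add: at_within_Icc_at)
    then show "\<exists>y. (h has_real_derivative y) (at t) \<and> 0 \<le> y"
      using hder[of t] ge[of t] t
      by (intro exI[of _ "(g' t - c * g t) * exp (- c * t)"]) auto
  next
    show "continuous_on {0..T} h"
      using hder by (meson DERIV_continuous continuous_on_eq_continuous_within)
  qed
  then show ?thesis by (simp add: h_def exp_minus field_simps)
qed

lemma exponential_upper_bound:
  fixes g :: "real \<Rightarrow> real"
  assumes der: "\<And>t. t \<in> {0..T} \<Longrightarrow> (g has_real_derivative g' t) (at t within {0..T})"
    and le: "\<And>t. t \<in> {0..T} \<Longrightarrow> g' t \<le> c * g t" and "0 \<le> T"
  shows "g T \<le> g 0 * exp (c * T)"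
  using exponential_lower_bound[of T "\<lambda>t. - g t" "\<lambda>t. - g' t" c] assms
  by (auto intro: derivative_intros)

section \<open>Stability and instability of the saturated field\<close>

definition map_vec :: "(real \<Rightarrow> real) \<Rightarrow> real ^ 'n \<Rightarrow> real ^ 'n" where
  "map_vec S y = (\<chi> i. S (y $ i))"

lemma map_vec_nth [simp]: "map_vec S y $ i = S (y $ i)"
  by (simp add: map_vec_def)

definition saturated_field ::
  "(real \<Rightarrow> real) \<Rightarrow> real \<Rightarrow> real ^ 'n ^ 'n \<Rightarrow> real \<Rightarrow> real ^ 'n \<Rightarrow> real ^ 'n" where
  "saturated_field S d B u x = u *\<^sub>R map_vec S (B *v x) - d *\<^sub>R x"

lemma shifted_matrix_vector_mult:
  fixes A :: "real ^ 'n ^ 'n"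
  shows "(mat \<alpha> + \<gamma> *\<^sub>R A) *v x = \<alpha> *\<^sub>R x + \<gamma> *\<^sub>R (A *v x)"
proof -
  have mat: "mat \<alpha> = \<alpha> *\<^sub>R (mat 1 :: real ^ 'n ^ 'n)"
    by (simp add: vec_eq_iff mat_def)
  have "mat \<alpha> *v x = \<alpha> *\<^sub>R x"
    by (metis matrix_vector_mul_lid scaleR_matrix_vector_assoc mat)
  then show ?thesis
    by (simp add: matrix_vector_mult_add_rdistrib scaleR_matrix_vector_assoc)
qed

lemma opinion_field_eq_saturated_field:
  fixes A :: "real ^ 'n ^ 'n"
  assumes "\<And>i. A $ i $ i = 0"
  shows "opinion_field S d \<alpha> \<gamma> A u = saturated_field S d (mat \<alpha> + \<gamma> *\<^sub>R A) u"
proof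
  fix x
  have "(\<Sum>k\<in>UNIV - {i}. A $ i $ k * x $ k) = (A *v x) $ i" for i
    using sum.remove[of UNIV i "\<lambda>k. A $ i $ k * x $ k"] assms[of i]
    by (simp add: matrix_vector_mult_def)
  then show "opinion_field S d \<alpha> \<gamma> A u x = saturated_field S d (mat \<alpha> + \<gamma> *\<^sub>R A) u x"
    by (simp add: vec_eq_iff opinion_field_def saturated_field_def shifted_matrix_vector_mult)
qed

lemma map_vec_zero: "saturation S \<Longrightarrow> map_vec S 0 = 0"
  by (simp add: vec_eq_iff saturation_zero)

lemma saturated_field_zero: "saturation S \<Longrightarrow> saturated_field S d B u 0 = 0"
  by (simp add: saturated_field_def map_vec_zero)

lemma norm_map_vec_diff_le:
  assumes "saturation S"
  shows "norm (map_vec S x - map_vec S y) \<le> norm (x - y)"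
  by (rule norm_le_componentwise_cart) (simp add: saturation_lipschitz[OF assms])

lemma map_vec_near_identity:
  fixes B :: "real ^ 'n ^ 'n"
  assumes "saturation S" "0 < e"
  obtains \<eta> where "0 < \<eta>" "\<And>x. norm x < \<eta> \<Longrightarrow> norm (map_vec S (B *v x) - B *v x) \<le> e * norm x"
proof -
  obtain K where K: "K > 0" "\<And>x. norm (B *v x) \<le> norm x * K"
    using bounded_linear.pos_bounded[OF matrix_vector_mul_bounded_linear[of B]] by metis
  obtain \<delta> where \<delta>: "0 < \<delta>" "\<And>z. \<bar>z\<bar> < \<delta> \<Longrightarrow> \<bar>S z - z\<bar> \<le> e / K * \<bar>z\<bar>"
    using saturation_near_identity[OF assms(1), of "e / K"] assms(2) K by auto
  show thesis
  proof (rule that)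
    show "0 < \<delta> / K" using \<delta> K by simp
    fix x :: "real ^ 'n" assume x: "norm x < \<delta> / K"
    have "norm (B *v x) < \<delta>" using K(2)[of x] x K(1) by (simp add: field_simps)
    then have "\<bar>(B *v x) $ i\<bar> < \<delta>" for i
      using component_le_norm_cart[of "B *v x" i] by linarith
    then have "norm (map_vec S (B *v x) - B *v x) \<le> norm ((e / K) *\<^sub>R (B *v x))"
      using assms(2) K \<delta>(2) by (intro norm_le_componentwise_cart) (simp add: abs_mult)
    also have "\<dots> = e / K * norm (B *v x)" using assms(2) K by simp
    also have "\<dots> \<le> e / K * (norm x * K)"
      using assms(2) K by (intro mult_left_mono) auto
    finally show "norm (map_vec S (B *v x) - B *v x) \<le> e * norm x" using K by simp
  qed
qed

lemma saturated_field_linearization: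
  fixes B :: "real ^ 'n ^ 'n"
  assumes "saturation S"
  shows "(saturated_field S d B u has_derivative (\<lambda>h. u *\<^sub>R (B *v h) - d *\<^sub>R h)) (at 0)"
proof -
  have "((\<lambda>x. map_vec S (B *v x)) has_derivative (\<lambda>h. B *v h)) (at 0)"
    unfolding has_derivative_at_alt
  proof (intro conjI allI impI)
    show "bounded_linear ((*v) B)" by simp
    fix e :: real assume "0 < e"
    then obtain \<eta> where "0 < \<eta>" "\<And>x. norm x < \<eta> \<Longrightarrow> norm (map_vec S (B *v x) - B *v x) \<le> e * norm x"
      using map_vec_near_identity[OF assms] by metis
    then show "\<exists>\<eta>>0. \<forall>y. norm (y - 0) < \<eta> \<longrightarrow>
        norm (map_vec S (B *v y) - map_vec S (B *v 0) - B *v (y - 0)) \<le> e * norm (y - 0)"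
      by (auto simp: map_vec_zero[OF assms])
  qed
  then show ?thesis
    unfolding saturated_field_def by (auto intro!: derivative_eq_intros)
qed

section \<open>Lyapunov criteria for stability and instability\<close>

lemma solution_on_subinterval:
  assumes "solution_on f T x" "T' \<le> T"
  shows "solution_on f T' x"
  using assms unfolding solution_on_def
  by (auto intro: has_vector_derivative_within_subset[where S = "{0..T}"])

lemma solution_on_component:
  fixes f :: "real ^ 'n \<Rightarrow> real ^ 'n"
  assumes "solution_on f T x" "t \<in> {0..T}"
  shows "((\<lambda>t. x t $ i) has_real_derivative f (x t) $ i) (at t within {0..T})"
  using bounded_linear.has_vector_derivative[OF bounded_linear_vec_nth] assms
  unfolding solution_on_def has_real_derivative_iff_has_vector_derivative by blast

text \<open>A Lyapunov argument for the form with weights \<open>D\<close>. Dissipation is only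
  assumed in a ball, so trajectories must first be confined: a sublevel set of \<open>V\<close> lies
  inside the ball, and decay of \<open>V\<close> prevents the exit from it.\<close>

lemma locally_exponentially_stable_if_dissipative:
  fixes f :: "real ^ 'n \<Rightarrow> real ^ 'n" and D :: "'n \<Rightarrow> real"
  assumes f0: "f 0 = 0" and D: "\<And>i. 0 < D i" and r: "0 < r" and \<eta>: "0 < \<eta>"
    and diss: "\<And>x. norm x < \<eta> \<Longrightarrow>
      (\<Sum>i\<in>UNIV. D i * x $ i * f x $ i) \<le> - r * (\<Sum>i\<in>UNIV. D i * (x $ i)\<^sup>2)"
  shows "locally_exponentially_stable f 0"
proof -
  define V where "V x = (\<Sum>i\<in>UNIV. D i * (x $ i)\<^sup>2)" for x :: "real ^ 'n"
  define m where "m = Min (range D)"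
  define M where "M = Max (range D)"
  have mD: "m \<le> D i" "D i \<le> M" for i by (auto simp: m_def M_def)
  have m: "0 < m" unfolding m_def using D by (subst Min_gr_iff) auto
  have M: "0 < M" using mD m by (meson less_le_trans)
  have normsq: "(norm x)\<^sup>2 = (\<Sum>i\<in>UNIV. (x $ i)\<^sup>2)" for x :: "real ^ 'n"
    unfolding power2_norm_eq_inner inner_vec_def by (simp add: power2_eq_square)
  have Vlow: "m * (norm x)\<^sup>2 \<le> V x" for x
    unfolding V_def normsq sum_distrib_left by (intro sum_mono mult_right_mono mD) auto
  have Vup: "V x \<le> M * (norm x)\<^sup>2" for x
    unfolding V_def normsq sum_distrib_left by (intro sum_mono mult_right_mono mD) auto
  define c where "c = m * \<eta>\<^sup>2 / 2"
  have c: "0 < c" using m \<eta> by (simp add: c_def)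
  have Vc: "norm x < \<eta>" if "V x \<le> c" for x
  proof -
    have "m * (norm x)\<^sup>2 \<le> m * \<eta>\<^sup>2 / 2" using Vlow[of x] that by (simp add: c_def)
    also have "\<dots> < m * \<eta>\<^sup>2" using m \<eta> by simp
    finally show ?thesis using m \<eta> by (simp add: power_less_imp_less_base)
  qed
  have der: "((\<lambda>t. V (x t)) has_real_derivative 2 * (\<Sum>i\<in>UNIV. D i * x t $ i * f (x t) $ i))
      (at t within {0..T})" if "solution_on f T x" "t \<in> {0..T}" for x T t
    unfolding V_def
    by (auto intro!: derivative_eq_intros solution_on_component[OF that] sum.cong
        simp: sum_distrib_left)
  have decay: "V (x T) \<le> V (x 0) * exp (- 2 * r * T)"
    if "solution_on f T x" "0 \<le> T" "\<And>t. t \<in> {0..T} \<Longrightarrow> V (x t) \<le> c" for x T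
  proof (rule exponential_upper_bound[OF der[OF that(1)] _ that(2)])
    fix t assume "t \<in> {0..T}"
    then show "2 * (\<Sum>i\<in>UNIV. D i * x t $ i * f (x t) $ i) \<le> - 2 * r * V (x t)"
      using diss[OF Vc, OF that(3)] by (simp add: V_def)
  qed
  have stay: "V (x t) < c" if sol: "solution_on f T x" and x0: "V (x 0) < c" and t: "t \<in> {0..T}" for x T t
  proof (rule ccontr)
    assume nt: "\<not> V (x t) < c"
    have cont: "continuous_on {0..T} (\<lambda>t. V (x t))"
      using der[OF sol] by (meson DERIV_continuous continuous_on_eq_continuous_within)
    define Z where "Z = {0..T} \<inter> (\<lambda>t. V (x t)) -` {c..}"
    have "closed Z" unfolding Z_def by (intro continuous_closed_preimage cont) auto
    moreover have "bounded Z" unfolding Z_def by (intro bounded_Int) auto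
    ultimately have "compact Z" by (simp add: compact_eq_bounded_closed)
    moreover have "Z \<noteq> {}" using nt t by (auto simp: Z_def)
    ultimately obtain t1 where t1: "t1 \<in> {0..T}" "c \<le> V (x t1)"
      and min: "\<And>s. s \<in> {0..T} \<Longrightarrow> c \<le> V (x s) \<Longrightarrow> t1 \<le> s"
      using compact_attains_inf[of Z] unfolding Z_def by (metis Int_iff atLeast_iff vimage_eq)
    have "continuous_on {0..t1} (\<lambda>t. V (x t))"
      using t1 by (intro continuous_on_subset[OF cont]) auto
    then obtain s where s: "0 \<le> s" "s \<le> t1" "V (x s) = c"
      using IVT'[of "\<lambda>t. V (x t)" 0 c t1] x0 t1 by auto
    \<comment> \<open>The intermediate value theorem yields a time with value exactly
      \<open>c\<close>, and minimality identifies it with \<open>t1\<close>. Hence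
      \<open>V \<le> c\<close> up to and including \<open>t1\<close>, and decay on
      \<open>{0..t1}\<close> contradicts \<open>V (x 0) < c\<close>.\<close>
    then have "s = t1" using min[of s] t1 by auto
    then have eq: "V (x t1) = c" using s by simp
    have "V (x t1) \<le> V (x 0) * exp (- 2 * r * t1)"
    proof (rule decay)
      show "solution_on f t1 x" using sol t1 by (auto intro: solution_on_subinterval)
      show "V (x t) \<le> c" if "t \<in> {0..t1}" for t
        using min[of t] that t1 eq by (cases "t = t1") force+
    qed (use t1 in auto)
    also have "\<dots> \<le> V (x 0) * 1"
      using r t1 Vlow[of "x 0"] m
      by (intro mult_left_mono) (auto intro: order_trans[of 0 "m * (norm (x 0))\<^sup>2"])
    finally show False using eq x0 by simp
  qed
  show ?thesis
    unfolding locally_exponentially_stable_def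
  proof (intro conjI exI allI impI ballI f0)
    \<comment> \<open>\<open>sqrt (c / M)\<close> comes from
      \<open>V x \<le> M * (norm x)\<^sup>2\<close> and makes \<open>V (x 0) < c\<close>;
      \<open>sqrt (M / m)\<close> is the price of passing from the norm to \<open>V\<close> and
      back.\<close>
    show "0 < sqrt (c / M)" "0 < sqrt (M / m)" "0 < r" using c m M r by auto
    fix T x t
    assume "solution_on f T x \<and> dist (x 0) 0 < sqrt (c / M)" and t: "t \<in> {0..T}"
    then have sol: "solution_on f T x" and "norm (x 0) < sqrt (c / M)" by auto
    then have "(norm (x 0))\<^sup>2 < (sqrt (c / M))\<^sup>2" by (intro power_strict_mono) auto
    then have "(norm (x 0))\<^sup>2 < c / M" using c M by simp
    then have "V (x 0) < c" using Vup[of "x 0"] M by (simp add: field_simps)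
    then have "V (x t) \<le> V (x 0) * exp (- 2 * r * t)"
      using t sol by (intro decay) (auto intro: solution_on_subinterval less_imp_le[OF stay])
    then have "m * (norm (x t))\<^sup>2 \<le> M * (norm (x 0))\<^sup>2 * exp (- 2 * r * t)"
      using Vlow[of "x t"] mult_right_mono[OF Vup[of "x 0"] exp_ge_zero[of "- 2 * r * t"]] by linarith
    then have "(norm (x t))\<^sup>2 \<le> M / m * ((norm (x 0))\<^sup>2 * exp (- 2 * r * t))"
      using m by (simp add: field_simps)
    also have "\<dots> = (sqrt (M / m) * exp (- r * t) * norm (x 0))\<^sup>2"
      using m M by (simp add: power_mult_distrib flip: exp_double)
    finally have "norm (x t) \<le> sqrt (M / m) * exp (- r * t) * norm (x 0)"
      using m M by (auto intro: power2_le_imp_le)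
    then show "dist (x t) 0 \<le> sqrt (M / m) * exp (- r * t) * dist (x 0) 0" by simp
  qed
qed

lemma exponential_growth_unbounded:
  fixes a c K :: real
  assumes "0 < a" "0 < c"
  obtains T where "0 \<le> T" "K < a * exp (c * T)"
proof
  define T where "T = max 0 (K / (a * c))"
  show "0 \<le> T" by (simp add: T_def)
  have "K \<le> a * (c * T)" using assms by (auto simp: T_def max_def field_simps)
  also have "\<dots> < a * exp (c * T)"
    using exp_ge_add_one_self[of "c * T"] assms(1) by (intro mult_strict_left_mono) linarith+
  finally show "K < a * exp (c * T)" .
qed

text \<open>Chetaev's argument: by symmetry of \<open>P\<close> the form
  \<open>x \<bullet> (P *v x)\<close> has derivative \<open>2 * ((P *v x) \<bullet> f x)\<close>.
  Where it starts positive, it grows exponentially as long as the solution stays in the ball, on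
  which it is bounded. Small multiples of \<open>v\<close> are such starting points.\<close>

lemma unstable_if_quadratic_form_expands:
  fixes f :: "real ^ 'n \<Rightarrow> real ^ 'n" and P :: "real ^ 'n ^ 'n"
  assumes f0: "f 0 = 0" and lip: "L-lipschitz_on UNIV f"
    and sym: "\<And>x y. x \<bullet> (P *v y) = (P *v x) \<bullet> y"
    and c: "0 < c" and \<eta>: "0 < \<eta>"
    and exp: "\<And>x. norm x < \<eta> \<Longrightarrow> c * (x \<bullet> (P *v x)) \<le> (P *v x) \<bullet> f x"
    and v: "0 < v \<bullet> (P *v v)"
  shows "unstable_equilibrium f 0"
  unfolding unstable_equilibrium_def
proof (intro conjI f0 notI)
  assume "lyapunov_stable f 0"
  then obtain \<delta> where \<delta>: "0 < \<delta>"
    and stable: "\<And>T x t. solution_on f T x \<Longrightarrow> norm (x 0) < \<delta> \<Longrightarrow> t \<in> {0..T} \<Longrightarrow> norm (x t) < \<eta>"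
    using \<eta> unfolding lyapunov_stable_def by (metis dist_0_norm dist_commute)
  have "v \<noteq> 0" using v by auto
  define s where "s = \<delta> / (2 * norm v)"
  have s: "0 < s" "norm (s *\<^sub>R v) < \<delta>" using \<delta> \<open>v \<noteq> 0\<close> by (auto simp: s_def)
  obtain K where K: "K > 0" "\<And>x. norm (P *v x) \<le> norm x * K"
    using bounded_linear.pos_bounded[OF matrix_vector_mul_bounded_linear[of P]] by metis
  define V where "V x = x \<bullet> (P *v x)" for x
  have Vv: "0 < V (s *\<^sub>R v)"
    using s v by (simp add: V_def matrix_vector_mult_scaleR)
  obtain T where T: "0 \<le> T" "K * \<eta>\<^sup>2 < V (s *\<^sub>R v) * exp (2 * c * T)"
    using exponential_growth_unbounded[OF Vv, of "2 * c"] c by auto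
  obtain x where sol: "solution_on f T x" and x0: "x 0 = s *\<^sub>R v"
    using solution_exists_if_lipschitz[OF lip T(1)] by metis
  have small: "norm (x t) < \<eta>" if "t \<in> {0..T}" for t
    using stable[OF sol _ that] x0 s by simp
  have "V (x 0) * exp ((2 * c) * T) \<le> V (x T)"
  proof (rule exponential_lower_bound[OF _ _ T(1)])
    fix t assume t: "t \<in> {0..T}"
    have xd: "(x has_vector_derivative f (x t)) (at t within {0..T})"
      using sol t by (auto simp: solution_on_def)
    have "((\<lambda>t. P *v x t) has_vector_derivative P *v f (x t)) (at t within {0..T})"
      using bounded_linear.has_vector_derivative[OF matrix_vector_mul_bounded_linear xd] .
    from bounded_bilinear.has_vector_derivative[OF bounded_bilinear_inner xd this]
    have "((\<lambda>t. V (x t)) has_vector_derivative x t \<bullet> (P *v f (x t)) + f (x t) \<bullet> (P *v x t)) (at t within {0..T})"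
      unfolding V_def .
    moreover have "x t \<bullet> (P *v f (x t)) + f (x t) \<bullet> (P *v x t) = 2 * ((P *v x t) \<bullet> f (x t))"
      using sym[of "x t" "f (x t)"] inner_commute[of "f (x t)" "P *v x t"] by linarith
    ultimately show "((\<lambda>t. V (x t)) has_real_derivative 2 * ((P *v x t) \<bullet> f (x t))) (at t within {0..T})"
      unfolding has_real_derivative_iff_has_vector_derivative by simp
    show "2 * c * V (x t) \<le> 2 * ((P *v x t) \<bullet> f (x t))"
      using exp[OF small[OF t]] by (simp add: V_def)
  qed
  moreover have "V (x T) \<le> K * \<eta>\<^sup>2"
  proof -
    have nT: "norm (x T) < \<eta>" using small T by simp
    have "V (x T) \<le> norm (x T) * (norm (x T) * K)"
      unfolding V_def using norm_cauchy_schwarz[of "x T" "P *v x T"] K(2)[of "x T"]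
      by (meson mult_left_mono norm_ge_zero order_trans)
    also have "\<dots> \<le> \<eta> * (\<eta> * K)"
      using nT K \<eta> by (intro mult_mono) auto
    finally show ?thesis by (simp add: power2_eq_square mult_ac)
  qed
  ultimately show False using T x0 by simp
qed

section \<open>Perron eigenvectors of irreducible nonnegative matrices\<close>

text \<open>Irreducibility is strong connectedness of the digraph of positive entries. Reflexivity
  of the closure admits the zero matrix of size 1, which is why a positive Perron root is claimed
  only for at least two indices.\<close>

definition irreducible_nonneg_matrix :: "real ^ 'n ^ 'n \<Rightarrow> bool" where
  "irreducible_nonneg_matrix A \<longleftrightarrow>
    (\<forall>i k. 0 \<le> A $ i $ k) \<and> (\<forall>i k. (i, k) \<in> {(i, k). 0 < A $ i $ k}\<^sup>*)"

lemma irreducible_nonneg_matrix_transpose: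
  assumes "irreducible_nonneg_matrix A"
  shows "irreducible_nonneg_matrix (transpose A)"
proof -
  have "{(i, k). 0 < transpose A $ i $ k} = {(i, k). 0 < A $ i $ k}\<inverse>"
    by (auto simp: transpose_def)
  then show ?thesis
    using assms by (auto simp: irreducible_nonneg_matrix_def rtrancl_converse transpose_def)
qed

text \<open>At an index where \<open>z\<close> vanishes, the row of the eigenvalue equation is a
  vanishing sum of nonnegative terms, so \<open>z\<close> vanishes at all successors; zeros spread
  along paths to every index.\<close>

lemma nonneg_eigenvector_pos:
  fixes A :: "real ^ 'n ^ 'n"
  assumes irr: "irreducible_nonneg_matrix A" and eig: "A *v z = l *\<^sub>R z"
    and nonneg: "\<And>i. 0 \<le> z $ i" and "z \<noteq> 0"
  shows "0 < z $ i"
proof (rule ccontr)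
  assume "\<not> 0 < z $ i"
  then have zi: "z $ i = 0" using nonneg[of i] by linarith
  have "z $ k = 0" if "(i, k) \<in> {(i, k). 0 < A $ i $ k}\<^sup>*" for k
    using that
  proof (induction rule: rtrancl_induct)
    case (step j k)
    have "(\<Sum>m\<in>UNIV. A $ j $ m * z $ m) = 0"
      using arg_cong[OF eig, of "\<lambda>x. x $ j"] step.IH by (simp add: matrix_vector_mult_def)
    moreover have "0 \<le> A $ j $ m * z $ m" for m
      using irr nonneg by (simp add: irreducible_nonneg_matrix_def)
    ultimately have "A $ j $ k * z $ k = 0"
      by (simp add: sum_nonneg_eq_0_iff)
    then show ?case using step.hyps by auto
  qed (rule zi)
  then have "z = 0" using irr by (simp add: irreducible_nonneg_matrix_def vec_eq_iff)
  then show False using \<open>z \<noteq> 0\<close> by simp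
qed

lemma irreducible_column_entry_pos:
  fixes A :: "real ^ 'n ^ 'n"
  assumes "irreducible_nonneg_matrix A" "CARD('n) \<ge> 2"
  obtains i where "0 < A $ i $ k"
proof -
  obtain j where "j \<noteq> k"
    using assms(2) by (metis UNIV_I card_2_iff' ex_card)
  moreover have "(j, k) \<in> {(i, k). 0 < A $ i $ k}\<^sup>*"
    using assms(1) by (simp add: irreducible_nonneg_matrix_def)
  ultimately show thesis using that by (auto elim: rtranclE)
qed

text \<open>Brouwer's theorem for the normalized map on the standard simplex. The normalizer
  \<open>\<sigma>\<close> is positive there because every column has a positive entry, and its value
  at the fixed point is the eigenvalue.\<close>

lemma perron_eigenvector:
  fixes A :: "real ^ 'n ^ 'n"
  assumes irr: "irreducible_nonneg_matrix A" and card: "CARD('n) \<ge> 2"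
  obtains v l where "\<And>i. 0 < v $ i" "0 < l" "A *v v = l *\<^sub>R v"
proof -
  have nn: "0 \<le> A $ i $ k" for i k using irr by (simp add: irreducible_nonneg_matrix_def)
  define K where "K = {x :: real ^ 'n. (\<forall>i. 0 \<le> x $ i) \<and> (\<Sum>i\<in>UNIV. x $ i) = 1}"
  define \<sigma> where "\<sigma> x = (\<Sum>i\<in>UNIV. (A *v x) $ i)" for x
  have Axnn: "0 \<le> (A *v x) $ i" if "x \<in> K" for x i
    using that nn by (auto simp: K_def matrix_vector_mult_def intro!: sum_nonneg)
  have \<sigma>pos: "0 < \<sigma> x" if x: "x \<in> K" for x
  proof -
    have "\<exists>k. 0 < x $ k"
    proof (rule ccontr)
      assume "\<nexists>k. 0 < x $ k"
      then have "x $ k \<le> 0" for k by (simp add: not_less)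
      then have "x $ k = 0" for k using x by (intro antisym) (auto simp: K_def)
      then show False using x by (simp add: K_def)
    qed
    then obtain k where k: "0 < x $ k" by blast
    obtain j where j: "0 < A $ j $ k" by (rule irreducible_column_entry_pos[OF irr card])
    have "0 < A $ j $ k * x $ k" using j k by simp
    also have "\<dots> \<le> (A *v x) $ j"
      unfolding matrix_vector_mult_def using nn x
      by (auto simp: K_def intro!: member_le_sum[where f = "\<lambda>k. A $ j $ k * x $ k"])
    also have "\<dots> \<le> \<sigma> x"
      unfolding \<sigma>_def using Axnn[OF x] by (intro member_le_sum) auto
    finally show ?thesis .
  qed
  have cont: "continuous_on K (\<lambda>x. A *v x)"
    by (rule linear_continuous_on) simp
  obtain v where v: "v \<in> K" "(A *v v) /\<^sub>R \<sigma> v = v"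
  proof (rule brouwer[of K "\<lambda>x. (A *v x) /\<^sub>R \<sigma> x"])
    have "closed K"
      unfolding K_def Collect_conj_eq Collect_all_eq
      by (intro closed_Int closed_INT ballI closed_Collect_le closed_Collect_eq continuous_intros)
    moreover have "bounded K"
    proof (rule boundedI)
      fix x assume "x \<in> K"
      then show "norm x \<le> 1"
        using norm_le_l1_cart[of x] by (simp add: K_def)
    qed
    ultimately show "compact K" by (simp add: compact_eq_bounded_closed)
    show "convex K"
      by (auto simp: K_def convex_def sum.distrib simp flip: sum_distrib_left)
    obtain k :: 'n where True by blast
    have "axis k 1 \<in> K" by (auto simp: K_def axis_def)
    then show "K \<noteq> {}" by blast
    show "continuous_on K (\<lambda>x. (A *v x) /\<^sub>R \<sigma> x)"
      unfolding \<sigma>_def using \<sigma>pos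
      by (intro continuous_intros cont) (auto simp: \<sigma>_def less_le)
    show "(\<lambda>x. (A *v x) /\<^sub>R \<sigma> x) \<in> K \<rightarrow> K"
    proof
      fix x assume x: "x \<in> K"
      have "(\<Sum>i\<in>UNIV. (A *v x) $ i / \<sigma> x) = 1"
        using \<sigma>pos[OF x] by (simp add: \<sigma>_def flip: sum_divide_distrib)
      then show "(A *v x) /\<^sub>R \<sigma> x \<in> K"
        using Axnn[OF x] \<sigma>pos[OF x] by (simp add: K_def divide_inverse mult.commute)
    qed
  qed
  have eig: "A *v v = \<sigma> v *\<^sub>R v"
  proof -
    have "\<sigma> v *\<^sub>R ((A *v v) /\<^sub>R \<sigma> v) = A *v v" using \<sigma>pos[OF v(1)] by simp
    then show ?thesis using v(2) by simp
  qed
  have "v \<noteq> 0" using v(1) by (auto simp: K_def)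
  then have "0 < v $ i" for i
    using v(1) by (intro nonneg_eigenvector_pos[OF irr eig]) (auto simp: K_def)
  then show thesis using that eig \<sigma>pos[OF v(1)] by blast
qed

section \<open>Left eigenvectors and the position of the Perron root in the spectrum\<close>

lemma inner_eigenvector_transpose:
  fixes A :: "real ^ 'n ^ 'n"
  assumes "transpose A *v w = l *\<^sub>R w"
  shows "w \<bullet> (A *v x) = l * (w \<bullet> x)"
  by (metis assms dot_lmul_matrix inner_scaleR_left transpose_matrix_vector)

lemma positive_inner_pos:
  fixes w x :: "real ^ 'n"
  assumes "\<And>i. 0 < w $ i" "\<And>i. 0 \<le> x $ i" "x \<noteq> 0"
  shows "0 < w \<bullet> x"
proof -
  obtain i where "x $ i \<noteq> 0" using assms(3) by (auto simp: vec_eq_iff)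
  then have "0 < w $ i * x $ i" using assms(1,2)[of i] by (simp add: less_le)
  then show ?thesis
    unfolding inner_vec_def inner_real_def
    using assms by (intro sum_pos2[of UNIV i]) (auto simp: less_imp_le)
qed

text \<open>The matrix and its transpose are treated separately; computing
  \<open>w \<bullet> (A *v v)\<close> in two ways, with \<open>w \<bullet> v > 0\<close>, shows that
  the two eigenvalues agree.\<close>

lemma perron_eigenvectors:
  fixes A :: "real ^ 'n ^ 'n"
  assumes irr: "irreducible_nonneg_matrix A" and card: "CARD('n) \<ge> 2"
  obtains v w l where "\<And>i. 0 < v $ i" "\<And>i. 0 < w $ i" "0 < l"
    "A *v v = l *\<^sub>R v" "transpose A *v w = l *\<^sub>R w"
proof -
  obtain v l where v: "\<And>i. 0 < v $ i" "0 < l" "A *v v = l *\<^sub>R v"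
    using perron_eigenvector[OF irr card] by blast
  obtain w k where w: "\<And>i. 0 < w $ i" "0 < k" "transpose A *v w = k *\<^sub>R w"
    using perron_eigenvector[OF irreducible_nonneg_matrix_transpose[OF irr] card] by blast
  have "v \<noteq> 0" using v(1) by (metis less_irrefl zero_index)
  then have "0 < w \<bullet> v" using v w by (intro positive_inner_pos) (auto simp: less_imp_le)
  moreover have "l * (w \<bullet> v) = k * (w \<bullet> v)"
    using inner_eigenvector_transpose[OF w(3), of v] v(3) by simp
  ultimately have "k = l" by simp
  then show thesis using that v w by blast
qed

text \<open>Taking moduli in the eigenvalue equation gives
  \<open>cmod m * a $ i \<le> (A *v a) $ i\<close> for the vector \<open>a\<close> of moduli;
  pairing with the positive left eigenvector \<open>w\<close> turns this into the bound by
  \<open>l\<close>.\<close>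

lemma perron_spectral_bound:
  fixes A :: "real ^ 'n ^ 'n"
  assumes nn: "\<And>i k. 0 \<le> A $ i $ k" and w: "\<And>i. 0 < w $ i"
    and eig: "transpose A *v w = l *\<^sub>R w" and m: "complex_eigenvalue A m"
  shows "cmod m \<le> l"
proof -
  obtain z :: "complex ^ 'n" where z: "z \<noteq> 0" "map_matrix complex_of_real A *v z = m *s z"
    using m by (auto simp: complex_eigenvalue_def)
  define a :: "real ^ 'n" where "a = (\<chi> i. cmod (z $ i))"
  have le: "cmod m * a $ i \<le> (A *v a) $ i" for i
  proof -
    have "m * z $ i = (\<Sum>k\<in>UNIV. complex_of_real (A $ i $ k) * z $ k)"
      using arg_cong[OF z(2), of "\<lambda>x. x $ i"] by (simp add: matrix_vector_mult_def)
    then have "cmod m * a $ i = cmod (\<Sum>k\<in>UNIV. complex_of_real (A $ i $ k) * z $ k)"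
      by (simp add: a_def flip: norm_mult)
    also have "\<dots> \<le> (\<Sum>k\<in>UNIV. cmod (complex_of_real (A $ i $ k) * z $ k))"
      by (rule norm_sum)
    also have "\<dots> = (A *v a) $ i"
      using nn by (simp add: a_def matrix_vector_mult_def norm_mult)
    finally show ?thesis .
  qed
  have "a \<noteq> 0" using z(1) by (auto simp: a_def vec_eq_iff)
  then have pos: "0 < w \<bullet> a" by (intro positive_inner_pos w) (auto simp: a_def)
  have "cmod m * (w \<bullet> a) = (\<Sum>i\<in>UNIV. w $ i * (cmod m * a $ i))"
    by (simp add: inner_vec_def sum_distrib_left mult_ac)
  also have "\<dots> \<le> (\<Sum>i\<in>UNIV. w $ i * (A *v a) $ i)"
    using w by (intro sum_mono mult_left_mono le) (auto simp: less_imp_le)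
  also have "\<dots> = l * (w \<bullet> a)"
    using inner_eigenvector_transpose[OF eig, of a] by (simp add: inner_vec_def)
  finally show ?thesis using pos by simp
qed

lemma complex_eigenvalue_of_real:
  fixes A :: "real ^ 'n ^ 'n"
  assumes "A *v v = l *\<^sub>R v" "v \<noteq> 0"
  shows "complex_eigenvalue A (complex_of_real l)"
  unfolding complex_eigenvalue_def
proof (intro exI conjI)
  show "(\<chi> i. complex_of_real (v $ i)) \<noteq> 0"
    using assms(2) by (simp add: vec_eq_iff)
  have "(\<Sum>k\<in>UNIV. A $ i $ k * v $ k) = l * v $ i" for i
    using arg_cong[OF assms(1), of "\<lambda>x. x $ i"] by (simp add: matrix_vector_mult_def)
  then have "(\<Sum>k\<in>UNIV. complex_of_real (A $ i $ k) * complex_of_real (v $ k))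
      = complex_of_real l * complex_of_real (v $ i)" for i
    by (metis (no_types, lifting) of_real_mult of_real_sum sum.cong)
  then show "map_matrix complex_of_real A *v (\<chi> i. complex_of_real (v $ i)) =
      complex_of_real l *s (\<chi> i. complex_of_real (v $ i))"
    by (simp add: vec_eq_iff matrix_vector_mult_def)
qed

text \<open>\<open>l\<close> is itself an eigenvalue, so \<open>l \<le> Re m\<close>, while
  \<open>cmod m \<le> l\<close>; together they leave no room for an imaginary part.\<close>

lemma perron_eigenvalue_max_Re:
  fixes A :: "real ^ 'n ^ 'n"
  assumes nn: "\<And>i k. 0 \<le> A $ i $ k" and w: "\<And>i. 0 < w $ i"
    and left: "transpose A *v w = l *\<^sub>R w"
    and right: "A *v v = l *\<^sub>R v" "v \<noteq> 0" and m: "eigenvalue_max_Re A m"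
  shows "m = complex_of_real l"
proof -
  have "cmod m \<le> l"
    using m by (intro perron_spectral_bound[OF nn w left]) (auto simp: eigenvalue_max_Re_def)
  moreover have "l \<le> Re m"
    using m complex_eigenvalue_of_real[OF right] by (auto simp: eigenvalue_max_Re_def)
  ultimately have "Re m = l" "cmod m = \<bar>Re m\<bar>"
    using complex_Re_le_cmod[of m] abs_Re_le_cmod[of m] by linarith+
  then show ?thesis using cmod_power2[of m] by (simp add: complex_eq_iff)
qed

text \<open>Subtract from \<open>z\<close> the largest multiple of \<open>v\<close> that leaves a
  nonnegative vector. The difference satisfies the eigenvalue equation and has a zero entry, so it
  vanishes by \<open>nonneg_eigenvector_pos\<close>.\<close>

lemma perron_eigenspace:
  fixes A :: "real ^ 'n ^ 'n"
  assumes irr: "irreducible_nonneg_matrix A" and v: "\<And>i. 0 < v $ i"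
    and eig: "A *v v = l *\<^sub>R v" and z: "A *v z = l *\<^sub>R z"
  obtains a where "z = a *\<^sub>R v"
proof -
  define a where "a = Min (range (\<lambda>i. z $ i / v $ i))"
  have "a \<in> range (\<lambda>i. z $ i / v $ i)" unfolding a_def by (intro Min_in) auto
  then obtain j where j: "a = z $ j / v $ j" by auto
  have le: "a \<le> z $ i / v $ i" for i by (simp add: a_def)
  have nonneg: "0 \<le> (z - a *\<^sub>R v) $ i" for i
    using le[of i] v[of i] by (simp add: pos_le_divide_eq)
  have "A *v (z - a *\<^sub>R v) = l *\<^sub>R (z - a *\<^sub>R v)"
    by (simp add: matrix_vector_mult_diff_distrib matrix_vector_mult_scaleR eig z
        scaleR_diff_right)
  moreover have "(z - a *\<^sub>R v) $ j = 0" using v[of j] by (simp add: j)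
  ultimately have "z - a *\<^sub>R v = 0"
    using nonneg_eigenvector_pos[OF irr _ nonneg, of l j] by auto
  then show thesis using that[of a] by simp
qed

text \<open>If the square of \<open>A - mat l\<close> has no larger kernel than
  \<open>A - mat l\<close>, the exponent in \<open>(M ^^ k) z = 0\<close> can be lowered one at a
  time.\<close>

lemma generalized_eigenspace_eq_eigenspace:
  fixes A :: "real ^ 'n ^ 'n"
  assumes ss: "\<And>z. (A - mat l) *v ((A - mat l) *v z) = 0 \<Longrightarrow> (A - mat l) *v z = 0"
  shows "generalized_eigenspace A l = {z. A *v z = l *\<^sub>R z}"
proof -
  define M where "M z = (A - mat l) *v z" for z
  have M0: "M z = 0 \<longleftrightarrow> A *v z = l *\<^sub>R z" for z
    by (simp add: M_def matrix_vector_mult_diff_rdistrib shifted_matrix_vector_mult[of l 0, simplified])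
  have "M z = 0" if "(M ^^ k) z = 0" for k z
    using that
  proof (induction k)
    case 0
    then show ?case by (simp add: M_def)
  next
    case (Suc k)
    show ?case
    proof (cases k)
      case 0
      then show ?thesis using Suc.prems by simp
    next
      case (Suc j)
      then have "M (M ((M ^^ j) z)) = 0" using Suc.prems by simp
      then have "(M ^^ k) z = 0" using ss Suc by (simp add: M_def)
      then show ?thesis by (rule Suc.IH)
    qed
  qed
  then have "(\<exists>k. (M ^^ k) z = 0) \<longleftrightarrow> M z = 0" for z
    by (metis funpow_0 funpow_simps_right(2) comp_apply)
  then show ?thesis
    unfolding generalized_eigenspace_def M_def[symmetric] M0 by simp
qed

text \<open>If \<open>(A - mat l) *v z\<close> lies in the kernel, it is a multiple of
  \<open>v\<close>, yet orthogonal to \<open>w\<close> because \<open>w\<close> is a left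
  eigenvector; as \<open>w \<bullet> v > 0\<close>, it is zero.\<close>

lemma perron_generalized_eigenspace:
  fixes A :: "real ^ 'n ^ 'n"
  assumes irr: "irreducible_nonneg_matrix A" and v: "\<And>i. 0 < v $ i" and w: "\<And>i. 0 < w $ i"
    and right: "A *v v = l *\<^sub>R v" and left: "transpose A *v w = l *\<^sub>R w"
  shows "generalized_eigenspace A l = {z. A *v z = l *\<^sub>R z}"
proof (rule generalized_eigenspace_eq_eigenspace)
  have M: "(A - mat l) *v z = A *v z - l *\<^sub>R z" for z
    by (simp add: matrix_vector_mult_diff_rdistrib shifted_matrix_vector_mult[of l 0, simplified])
  fix z assume "(A - mat l) *v ((A - mat l) *v z) = 0"
  then obtain a where a: "(A - mat l) *v z = a *\<^sub>R v"
    using perron_eigenspace[OF irr v right, of "(A - mat l) *v z"] by (auto simp: M)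
  have "w \<bullet> ((A - mat l) *v z) = 0"
    by (simp add: M inner_diff_right inner_eigenvector_transpose[OF left])
  moreover have "0 < w \<bullet> v"
    using v w by (intro positive_inner_pos) (auto simp: less_imp_le vec_eq_iff less_le)
  ultimately show "(A - mat l) *v z = 0" using a by simp
qed

section \<open>Cooperative saturated fields\<close>

text \<open>With \<open>x $ i = v $ i * a i\<close>, AM-GM splits each mixed term into a part with
  \<open>(a i)\<^sup>2\<close>, summed over \<open>k\<close> by the right eigenvector equation, and
  one with \<open>(a k)\<^sup>2\<close>, summed over \<open>i\<close> by the left one. Each
  contributes half of the bound.\<close>

lemma perron_weighted_form_le:
  fixes B :: "real ^ 'n ^ 'n"
  assumes nn: "\<And>i k. 0 \<le> B $ i $ k" and v: "\<And>i. 0 < v $ i" and w: "\<And>i. 0 < w $ i"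
    and right: "B *v v = \<mu> *\<^sub>R v" and left: "transpose B *v w = \<mu> *\<^sub>R w"
  shows "(\<Sum>i\<in>UNIV. w $ i / v $ i * \<bar>x $ i\<bar> * (\<Sum>k\<in>UNIV. B $ i $ k * \<bar>x $ k\<bar>))
    \<le> \<mu> * (\<Sum>i\<in>UNIV. w $ i / v $ i * (x $ i)\<^sup>2)"
proof -
  define a where "a i = x $ i / v $ i" for i
  have xa: "x $ i = v $ i * a i" for i using v[of i] by (simp add: a_def)
  have row: "(\<Sum>k\<in>UNIV. B $ i $ k * v $ k) = \<mu> * v $ i" for i
    using arg_cong[OF right, of "\<lambda>x. x $ i"] by (simp add: matrix_vector_mult_def)
  have col: "(\<Sum>i\<in>UNIV. B $ i $ k * w $ i) = \<mu> * w $ k" for k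
    using arg_cong[OF left, of "\<lambda>x. x $ k"] by (simp add: matrix_vector_mult_def transpose_def)
  have form: "w $ i / v $ i * (x $ i)\<^sup>2 = w $ i * v $ i * (a i)\<^sup>2" for i
    using v[of i] by (simp add: xa power2_eq_square)
  have am_gm: "w $ i / v $ i * \<bar>x $ i\<bar> * (B $ i $ k * \<bar>x $ k\<bar>)
      \<le> (w $ i * (a i)\<^sup>2 * (B $ i $ k * v $ k) + v $ k * (a k)\<^sup>2 * (B $ i $ k * w $ i)) / 2" for i k
  proof -
    have "w $ i / v $ i * \<bar>x $ i\<bar> * (B $ i $ k * \<bar>x $ k\<bar>)
        = w $ i * B $ i $ k * v $ k * (\<bar>a i\<bar> * \<bar>a k\<bar>)"
      using v[of i] v[of k] by (simp add: xa abs_mult)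
    also have "\<dots> \<le> w $ i * B $ i $ k * v $ k * (((a i)\<^sup>2 + (a k)\<^sup>2) / 2)"
      using sum_squares_bound[of "\<bar>a i\<bar>" "\<bar>a k\<bar>"] v[of k] w[of i] nn[of i k]
      by (intro mult_left_mono) (auto simp: less_imp_le)
    finally show ?thesis by (simp add: algebra_simps add_divide_distrib)
  qed
  have "(\<Sum>i\<in>UNIV. w $ i / v $ i * \<bar>x $ i\<bar> * (\<Sum>k\<in>UNIV. B $ i $ k * \<bar>x $ k\<bar>))
      = (\<Sum>i\<in>UNIV. \<Sum>k\<in>UNIV. w $ i / v $ i * \<bar>x $ i\<bar> * (B $ i $ k * \<bar>x $ k\<bar>))"
    by (simp only: sum_distrib_left)
  also have "\<dots> \<le> (\<Sum>i\<in>UNIV. \<Sum>k\<in>UNIV.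
      (w $ i * (a i)\<^sup>2 * (B $ i $ k * v $ k) + v $ k * (a k)\<^sup>2 * (B $ i $ k * w $ i)) / 2)"
    by (intro sum_mono am_gm)
  also have "\<dots> = ((\<Sum>i\<in>UNIV. \<Sum>k\<in>UNIV. w $ i * (a i)\<^sup>2 * (B $ i $ k * v $ k))
      + (\<Sum>i\<in>UNIV. \<Sum>k\<in>UNIV. v $ k * (a k)\<^sup>2 * (B $ i $ k * w $ i))) / 2"
    by (simp only: sum.distrib flip: sum_divide_distrib)
  also have "(\<Sum>i\<in>UNIV. \<Sum>k\<in>UNIV. w $ i * (a i)\<^sup>2 * (B $ i $ k * v $ k))
      = \<mu> * (\<Sum>i\<in>UNIV. w $ i * v $ i * (a i)\<^sup>2)"
    unfolding sum_distrib_left[symmetric] row by (simp add: sum_distrib_left mult_ac)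
  also have "(\<Sum>i\<in>UNIV. \<Sum>k\<in>UNIV. v $ k * (a k)\<^sup>2 * (B $ i $ k * w $ i))
      = (\<Sum>k\<in>UNIV. v $ k * (a k)\<^sup>2 * (\<Sum>i\<in>UNIV. B $ i $ k * w $ i))"
    by (subst sum.swap) (simp only: sum_distrib_left)
  also have "\<dots> = \<mu> * (\<Sum>i\<in>UNIV. w $ i * v $ i * (a i)\<^sup>2)"
    unfolding col by (simp add: sum_distrib_left mult_ac)
  finally show ?thesis unfolding form by simp
qed

lemma saturated_field_stable_perron:
  fixes B :: "real ^ 'n ^ 'n"
  assumes S: "saturation S" and nn: "\<And>i k. 0 \<le> B $ i $ k"
    and v: "\<And>i. 0 < v $ i" and w: "\<And>i. 0 < w $ i"
    and right: "B *v v = \<mu> *\<^sub>R v" and left: "transpose B *v w = \<mu> *\<^sub>R w"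
    and u: "0 < u" "u * \<mu> < d"
  shows "locally_exponentially_stable (saturated_field S d B u) 0"
proof (rule locally_exponentially_stable_if_dissipative)
  show "saturated_field S d B u 0 = 0" by (rule saturated_field_zero[OF S])
  show "0 < w $ i / v $ i" for i using v w by simp
  show "0 < d - u * \<mu>" using u by simp
  \<comment> \<open>\<open>\<bar>S z\<bar> \<le> \<bar>z\<bar>\<close> holds globally, so the
    dissipation estimate does too and the radius \<open>1\<close> is arbitrary.\<close>
  show "(0::real) < 1" by simp
  fix x :: "real ^ 'n"
  let ?V = "\<Sum>i\<in>UNIV. w $ i / v $ i * (x $ i)\<^sup>2"
  have le: "w $ i / v $ i * x $ i * saturated_field S d B u x $ i
      \<le> u * (w $ i / v $ i * \<bar>x $ i\<bar> * (\<Sum>k\<in>UNIV. B $ i $ k * \<bar>x $ k\<bar>)) - d * (w $ i / v $ i * (x $ i)\<^sup>2)"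
    for i
  proof -
    have "\<bar>S ((B *v x) $ i)\<bar> \<le> \<bar>(B *v x) $ i\<bar>" by (rule saturation_abs_le[OF S])
    also have "\<dots> \<le> (\<Sum>k\<in>UNIV. B $ i $ k * \<bar>x $ k\<bar>)"
      unfolding matrix_vector_mult_def using nn
      by (simp add: order_trans[OF sum_abs] abs_mult)
    finally have "\<bar>x $ i * S ((B *v x) $ i)\<bar> \<le> \<bar>x $ i\<bar> * (\<Sum>k\<in>UNIV. B $ i $ k * \<bar>x $ k\<bar>)"
      by (simp add: abs_mult mult_left_mono)
    then have "x $ i * S ((B *v x) $ i) \<le> \<bar>x $ i\<bar> * (\<Sum>k\<in>UNIV. B $ i $ k * \<bar>x $ k\<bar>)"
      by linarith
    then have "(u * (w $ i / v $ i)) * (x $ i * S ((B *v x) $ i))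
        \<le> (u * (w $ i / v $ i)) * (\<bar>x $ i\<bar> * (\<Sum>k\<in>UNIV. B $ i $ k * \<bar>x $ k\<bar>))"
      using u v[of i] w[of i] by (intro mult_left_mono) auto
    then show ?thesis
      by (simp add: saturated_field_def algebra_simps power2_eq_square)
  qed
  have "(\<Sum>i\<in>UNIV. w $ i / v $ i * x $ i * saturated_field S d B u x $ i)
      \<le> (\<Sum>i\<in>UNIV. u * (w $ i / v $ i * \<bar>x $ i\<bar> * (\<Sum>k\<in>UNIV. B $ i $ k * \<bar>x $ k\<bar>)) - d * (w $ i / v $ i * (x $ i)\<^sup>2))"
    by (intro sum_mono le)
  also have "\<dots> = u * (\<Sum>i\<in>UNIV. w $ i / v $ i * \<bar>x $ i\<bar> * (\<Sum>k\<in>UNIV. B $ i $ k * \<bar>x $ k\<bar>)) - d * ?V"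
    by (simp only: sum_subtractf sum_distrib_left)
  also have "\<dots> \<le> u * (\<mu> * ?V) - d * ?V"
    using u by (intro diff_right_mono mult_left_mono perron_weighted_form_le[OF nn v w right left]) auto
  finally show "(\<Sum>i\<in>UNIV. w $ i / v $ i * x $ i * saturated_field S d B u x $ i)
      \<le> - (d - u * \<mu>) * ?V"
    by (simp add: algebra_simps)
qed

lemma saturated_field_unstable_perron:
  fixes B :: "real ^ 'n ^ 'n"
  assumes S: "saturation S" and nn: "\<And>i k. 0 \<le> B $ i $ k"
    and w: "\<And>i. 0 < w $ i"
    and left: "transpose B *v w = \<mu> *\<^sub>R w" and "0 < \<mu>" and "0 < d" and u: "0 < u" "d < u * \<mu>"
  shows "unstable_equilibrium (saturated_field S d B u) 0"
  unfolding unstable_equilibrium_def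
proof (intro conjI notI)
  show "saturated_field S d B u 0 = 0" by (rule saturated_field_zero[OF S])
  assume stable: "lyapunov_stable (saturated_field S d B u) 0"
  obtain K where K: "K > 0" "\<And>x. norm (B *v x) \<le> norm x * K"
    using bounded_linear.pos_bounded[OF matrix_vector_mul_bounded_linear[of B]] by metis
  \<comment> \<open>The factor \<open>1 - e\<close> in \<open>S z \<ge> (1 - e) * z\<close> costs
    half of the gap: \<open>u * (1 - e) * \<mu> - d = (u * \<mu> - d) / 2\<close>, which is the
    growth rate \<open>c\<close> of \<open>w \<bullet> x\<close> below.\<close>
  define e where "e = (u * \<mu> - d) / (2 * u * \<mu>)"
  have e: "0 < e" using u \<open>0 < \<mu>\<close> by (simp add: e_def)
  obtain \<rho> where \<rho>: "0 < \<rho>" "\<And>z. \<bar>z\<bar> < \<rho> \<Longrightarrow> \<bar>S z - z\<bar> \<le> e * \<bar>z\<bar>"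
    using saturation_near_identity[OF S e] by metis
  define \<eta> where "\<eta> = \<rho> / K"
  have \<eta>: "0 < \<eta>" using \<rho> K by (simp add: \<eta>_def)
  obtain \<delta> where \<delta>: "0 < \<delta>"
    and small: "\<And>T x t. solution_on (saturated_field S d B u) T x \<Longrightarrow> norm (x 0) < \<delta> \<Longrightarrow>
      t \<in> {0..T} \<Longrightarrow> norm (x t) < \<eta>"
    using stable \<eta> unfolding lyapunov_stable_def by (metis dist_0_norm dist_commute)
  have "w \<noteq> 0" using w by (metis less_irrefl zero_index)
  define s where "s = \<delta> / (2 * norm w)"
  have s: "0 < s" "norm (s *\<^sub>R w) < \<delta>" using \<delta> \<open>w \<noteq> 0\<close> by (auto simp: s_def)
  \<comment> \<open>This field agrees with the given one on the positive orthant and leaves it invariant.\<close>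
  define G where "G x = u *\<^sub>R map_vec S (B *v map_vec abs x) - d *\<^sub>R x" for x
  have lip: "(u * K + d)-lipschitz_on UNIV G"
  proof (rule lipschitz_onI)
    fix x y :: "real ^ 'n"
    have "norm (map_vec S (B *v map_vec abs x) - map_vec S (B *v map_vec abs y))
        \<le> norm (B *v (map_vec abs x - map_vec abs y))"
      using norm_map_vec_diff_le[OF S] by (simp add: matrix_vector_mult_diff_distrib)
    also have "\<dots> \<le> norm (map_vec abs x - map_vec abs y) * K" by (rule K)
    also have "\<dots> \<le> norm (x - y) * K"
      using K by (intro mult_right_mono norm_le_componentwise_cart) auto
    finally have *: "norm (map_vec S (B *v map_vec abs x) - map_vec S (B *v map_vec abs y)) \<le> norm (x - y) * K" .
    have "G x - G y = u *\<^sub>R (map_vec S (B *v map_vec abs x) - map_vec S (B *v map_vec abs y)) - d *\<^sub>R (x - y)"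
      by (simp add: G_def algebra_simps)
    then have "dist (G x) (G y) \<le> norm (u *\<^sub>R (map_vec S (B *v map_vec abs x) - map_vec S (B *v map_vec abs y))) + norm (d *\<^sub>R (x - y))"
      unfolding dist_norm by (simp only: norm_triangle_ineq4)
    also have "\<dots> = u * norm (map_vec S (B *v map_vec abs x) - map_vec S (B *v map_vec abs y)) + d * norm (x - y)"
      using u \<open>0 < d\<close> by simp
    also have "\<dots> \<le> u * (norm (x - y) * K) + d * norm (x - y)"
      using u * by (intro add_right_mono mult_left_mono) auto
    finally show "dist (G x) (G y) \<le> (u * K + d) * dist x y"
      by (simp add: dist_norm algebra_simps)
  qed (use u K \<open>0 < d\<close> in auto)
  define c where "c = (u * \<mu> - d) / 2"
  have c: "0 < c" using u by (simp add: c_def)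
  have wv: "0 < w \<bullet> (s *\<^sub>R w)"
    using w s \<open>w \<noteq> 0\<close> positive_inner_pos[of w w] by (simp add: less_imp_le)
  obtain T where T: "0 \<le> T" "norm w * \<eta> < (w \<bullet> (s *\<^sub>R w)) * exp (c * T)"
    using exponential_growth_unbounded[OF wv c] by metis
  obtain x where solG: "solution_on G T x" and x0: "x 0 = s *\<^sub>R w"
    using solution_exists_if_lipschitz[OF lip T(1)] by metis
  have Snn: "0 \<le> S ((B *v map_vec abs y) $ i)" for y i
    using nn by (intro saturation_nonneg[OF S]) (auto simp: matrix_vector_mult_def intro!: sum_nonneg)
  \<comment> \<open>The saturated term of \<open>G\<close> is nonnegative, so each component decays
    no faster than \<open>exp (- d * t)\<close> and stays positive.\<close>
  have xpos: "0 < x t $ i" if t: "t \<in> {0..T}" for t i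
  proof -
    have "x 0 $ i * exp (- d * t) \<le> x t $ i"
    proof (rule exponential_lower_bound)
      fix r assume r: "r \<in> {0..t}"
      show "((\<lambda>r. x r $ i) has_real_derivative G (x r) $ i) (at r within {0..t})"
        using r t by (intro solution_on_component solution_on_subinterval[OF solG]) auto
      show "- d * x r $ i \<le> G (x r) $ i"
        using u Snn[of "x r" i] by (simp add: G_def)
    qed (use t in auto)
    moreover have "0 < x 0 $ i * exp (- d * t)" using s w x0 by simp
    ultimately show ?thesis by linarith
  qed
  have "G (x t) = saturated_field S d B u (x t)" if "t \<in> {0..T}" for t
  proof -
    have "map_vec abs (x t) = x t" using xpos[OF that] by (simp add: vec_eq_iff less_imp_le)
    then show ?thesis by (simp add: G_def saturated_field_def)
  qed
  then have sol: "solution_on (saturated_field S d B u) T x"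
    using solG by (simp add: solution_on_def)
  have xsmall: "norm (x t) < \<eta>" if "t \<in> {0..T}" for t
    using small[OF sol _ that] x0 s by simp
  have "w \<bullet> x 0 * exp (c * T) \<le> w \<bullet> x T"
  proof (rule exponential_lower_bound[OF _ _ T(1)])
    fix t assume t: "t \<in> {0..T}"
    have xd: "(x has_vector_derivative saturated_field S d B u (x t)) (at t within {0..T})"
      using sol t by (auto simp: solution_on_def)
    show "((\<lambda>t. w \<bullet> x t) has_real_derivative w \<bullet> saturated_field S d B u (x t)) (at t within {0..T})"
      unfolding has_real_derivative_iff_has_vector_derivative
      by (rule bounded_linear.has_vector_derivative[OF bounded_linear_inner_right xd])
    have "(1 - e) * (B *v x t) $ i \<le> S ((B *v x t) $ i)" for i
    proof -
      have "norm (x t) * K < \<rho>" using xsmall[OF t] K by (simp add: \<eta>_def field_simps)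
      then have "\<bar>(B *v x t) $ i\<bar> < \<rho>"
        using component_le_norm_cart[of "B *v x t" i] K(2)[of "x t"] by linarith
      moreover have "0 \<le> (B *v x t) $ i"
        using nn xpos[OF t] by (auto simp: matrix_vector_mult_def less_imp_le intro!: sum_nonneg)
      ultimately show ?thesis using \<rho>(2)[of "(B *v x t) $ i"] by (simp add: algebra_simps)
    qed
    then have "(\<Sum>i\<in>UNIV. w $ i * ((1 - e) * (B *v x t) $ i)) \<le> (\<Sum>i\<in>UNIV. w $ i * S ((B *v x t) $ i))"
      using w by (intro sum_mono mult_left_mono) (auto simp: less_imp_le)
    then have "(1 - e) * (w \<bullet> (B *v x t)) \<le> w \<bullet> map_vec S (B *v x t)"
      by (simp add: inner_vec_def sum_distrib_left mult_ac)
    then have "u * ((1 - e) * (\<mu> * (w \<bullet> x t))) \<le> u * (w \<bullet> map_vec S (B *v x t))"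
      using u by (simp add: inner_eigenvector_transpose[OF left])
    moreover have "u * ((1 - e) * (\<mu> * (w \<bullet> x t))) - d * (w \<bullet> x t) = c * (w \<bullet> x t)"
    proof -
      have c_eq: "c = u * (1 - e) * \<mu> - d"
        using u \<open>0 < \<mu>\<close> by (simp add: e_def c_def field_simps)
      show ?thesis unfolding c_eq by (simp add: algebra_simps)
    qed
    ultimately show "c * (w \<bullet> x t) \<le> w \<bullet> saturated_field S d B u (x t)"
      by (simp add: saturated_field_def inner_diff_right)
  qed
  moreover have "w \<bullet> x T \<le> norm w * \<eta>"
    using norm_cauchy_schwarz[of w "x T"] xsmall[of T] T
    by (meson atLeastAtMost_iff less_imp_le mult_left_mono norm_ge_zero order_refl order_trans)
  ultimately show False using T x0 by simp
qed

section \<open>Equilibria near the critical attention in the cooperative case\<close>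

lemma dist_equilibrium_le:
  fixes x :: "'a::real_normed_vector" and u u\<^sub>0 :: real
  shows "dist (x, u) (0, u\<^sub>0) \<le> norm x + \<bar>u - u\<^sub>0\<bar>"
  using sqrt_sum_squares_le_sum_abs[of "norm x" "\<bar>u - u\<^sub>0\<bar>"]
  by (simp add: dist_norm norm_Pair)

lemma equilibria_near_bifurcation_perron:
  fixes B :: "real ^ 'n ^ 'n"
  assumes S: "saturation S" and nn: "\<And>i k. 0 \<le> B $ i $ k" and v: "\<And>i. 0 < v $ i"
    and right: "B *v v = \<mu> *\<^sub>R v" and "0 < \<mu>" and "0 < d" and e: "0 < e"
  shows "\<exists>q\<in>nonzero_equilibria {0..} (saturated_field S d B). dist q (0, d / \<mu>) < e"
proof -
  have "v \<noteq> 0" using v by (metis less_irrefl zero_index)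
  define \<rho> where "\<rho> = e / (4 * norm v)"
  have \<rho>: "0 < \<rho>" "norm (\<rho> *\<^sub>R v) = e / 4" using e \<open>v \<noteq> 0\<close> by (auto simp: \<rho>_def)
  \<comment> \<open>\<open>U i\<close> is the attention at which \<open>\<rho> *\<^sub>R v\<close>
    is stationary in coordinate \<open>i\<close>; it exceeds \<open>d / \<mu>\<close> because
    \<open>S z < z\<close>. For positive \<open>u\<close> up to the least of them,
    \<open>\<rho> *\<^sub>R v\<close> is a supersolution.\<close>
  define U where "U i = d * (\<rho> * v $ i) / S (\<mu> * (\<rho> * v $ i))" for i
  define u where "u = Min (insert (d / \<mu> + e / 4) (range U))"
  have z: "0 < \<mu> * (\<rho> * v $ i)" for i using \<open>0 < \<mu>\<close> \<rho> v[of i] by simp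
  have Sz: "0 < S (\<mu> * (\<rho> * v $ i))" for i
    using saturation_strict_mono[OF S z[of i]] saturation_zero[OF S] by simp
  have "d / \<mu> < U i" for i
    using saturation_less[OF S z[of i]] Sz[of i] \<open>0 < \<mu>\<close> \<open>0 < d\<close>
    by (simp add: U_def field_simps)
  then have u_gt: "d / \<mu> < u" using e by (auto simp: u_def)
  have u_le: "u \<le> d / \<mu> + e / 4" "u \<le> U i" for i
    unfolding u_def by (rule Min_le; simp)+
  have u0: "0 < u" using u_gt \<open>0 < \<mu>\<close> \<open>0 < d\<close> by (meson divide_pos_pos less_trans)
  have super: "u / d * S (\<mu> * (\<rho> * v $ i)) \<le> \<rho> * v $ i" for i
    using u_le(2)[of i] Sz[of i] \<open>0 < d\<close> by (simp add: U_def field_simps)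
  \<comment> \<open>\<open>1 - \<theta> = d / (u * \<mu>)\<close>, so the bound
    \<open>S z \<ge> (1 - \<theta>) * z\<close> exactly balances the gain
    \<open>u * \<mu> / d\<close>, and a small multiple of \<open>v\<close> is a subsolution.\<close>
  define \<theta> where "\<theta> = 1 - d / (u * \<mu>)"
  have \<theta>: "0 < \<theta>" using u_gt u0 \<open>0 < \<mu>\<close> by (simp add: \<theta>_def field_simps)
  obtain \<delta> where \<delta>: "0 < \<delta>" "\<And>z. \<bar>z\<bar> < \<delta> \<Longrightarrow> \<bar>S z - z\<bar> \<le> \<theta> * \<bar>z\<bar>"
    using saturation_near_identity[OF S \<theta>] by metis
  define s where "s = min \<rho> (\<delta> / (2 * (\<mu> * norm v)))"
  have s: "0 < s" "s \<le> \<rho>" using \<rho> \<delta> \<open>0 < \<mu>\<close> \<open>v \<noteq> 0\<close> by (auto simp: s_def)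
  have sub: "s * v $ i \<le> u / d * S (\<mu> * (s * v $ i))" for i
  proof -
    have "s * (\<mu> * norm v) \<le> \<delta> / 2"
      using \<open>0 < \<mu>\<close> \<open>v \<noteq> 0\<close> by (simp add: s_def min_def field_simps)
    moreover have "\<mu> * (s * v $ i) \<le> s * (\<mu> * norm v)"
      using s \<open>0 < \<mu>\<close> component_le_norm_cart[of v i] by simp
    moreover have pos: "0 < \<mu> * (s * v $ i)" using s v[of i] \<open>0 < \<mu>\<close> by simp
    ultimately have "\<bar>\<mu> * (s * v $ i)\<bar> < \<delta>" using \<delta>(1) by linarith
    then have "(1 - \<theta>) * (\<mu> * (s * v $ i)) \<le> S (\<mu> * (s * v $ i))"
      using \<delta>(2)[of "\<mu> * (s * v $ i)"] pos by (simp add: left_diff_distrib)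
    then have "u / d * ((1 - \<theta>) * (\<mu> * (s * v $ i))) \<le> u / d * S (\<mu> * (s * v $ i))"
      using u0 \<open>0 < d\<close> by (intro mult_left_mono) auto
    then show ?thesis using u0 \<open>0 < d\<close> \<open>0 < \<mu>\<close> by (simp add: \<theta>_def)
  qed
  define \<Phi> where "\<Phi> x = (u / d) *\<^sub>R map_vec S (B *v x)" for x
  have mono: "(B *v x) $ i \<le> (B *v y) $ i" if "\<And>k. x $ k \<le> y $ k" for x y i
    unfolding matrix_vector_mult_def using that nn by (simp add: sum_mono mult_left_mono)
  have Bv: "(B *v (t *\<^sub>R v)) $ i = \<mu> * (t * v $ i)" for t i
    by (simp add: matrix_vector_mult_scaleR right)
  obtain x where x: "x \<in> cbox (s *\<^sub>R v) (\<rho> *\<^sub>R v)" "\<Phi> x = x"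
  proof (rule brouwer[of "cbox (s *\<^sub>R v) (\<rho> *\<^sub>R v)" \<Phi>])
    have "\<rho> *\<^sub>R v \<in> cbox (s *\<^sub>R v) (\<rho> *\<^sub>R v)"
      using s v by (simp add: mem_box_cart less_imp_le)
    then show "cbox (s *\<^sub>R v) (\<rho> *\<^sub>R v) \<noteq> {}" by blast
    show "continuous_on (cbox (s *\<^sub>R v) (\<rho> *\<^sub>R v)) \<Phi>"
      unfolding \<Phi>_def map_vec_def
      by (intro continuous_intros continuous_on_compose2[OF saturation_continuous[OF S, of UNIV]]
          linear_continuous_on) auto
    show "\<Phi> \<in> cbox (s *\<^sub>R v) (\<rho> *\<^sub>R v) \<rightarrow> cbox (s *\<^sub>R v) (\<rho> *\<^sub>R v)"
    proof
      fix x assume "x \<in> cbox (s *\<^sub>R v) (\<rho> *\<^sub>R v)"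
      then have lo: "(s *\<^sub>R v) $ k \<le> x $ k" and hi: "x $ k \<le> (\<rho> *\<^sub>R v) $ k" for k
        by (auto simp: mem_box_cart)
      have "S (\<mu> * (s * v $ i)) \<le> S ((B *v x) $ i)" "S ((B *v x) $ i) \<le> S (\<mu> * (\<rho> * v $ i))" for i
        using mono[of "s *\<^sub>R v" x i, OF lo] mono[of x "\<rho> *\<^sub>R v" i, OF hi]
        by (auto simp: Bv intro!: saturation_mono[OF S])
      then have "u / d * S (\<mu> * (s * v $ i)) \<le> u / d * S ((B *v x) $ i)"
        "u / d * S ((B *v x) $ i) \<le> u / d * S (\<mu> * (\<rho> * v $ i))" for i
        using u0 \<open>0 < d\<close> by (intro mult_left_mono; simp)+
      then show "\<Phi> x \<in> cbox (s *\<^sub>R v) (\<rho> *\<^sub>R v)"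
        unfolding mem_box_cart \<Phi>_def
        using order_trans[OF sub] order_trans[OF _ super] by simp
    qed
  qed (auto simp: compact_cbox convex_box)
  have xpos: "0 < x $ i" for i
    using x(1) s v[of i] by (auto simp: mem_box_cart intro: less_le_trans[of 0 "s * v $ i"])
  then have "x \<noteq> 0" by (metis less_irrefl zero_index)
  moreover have "saturated_field S d B u x = 0"
  proof -
    have "d *\<^sub>R x = d *\<^sub>R \<Phi> x" using x by simp
    also have "\<dots> = u *\<^sub>R map_vec S (B *v x)" using \<open>0 < d\<close> by (simp add: \<Phi>_def)
    finally show ?thesis by (simp add: saturated_field_def)
  qed
  ultimately have "(x, u) \<in> nonzero_equilibria {0..} (saturated_field S d B)"
    using u0 by (simp add: nonzero_equilibria_def)
  moreover have "dist (x, u) (0, d / \<mu>) < e"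
  proof -
    have "norm x \<le> norm (\<rho> *\<^sub>R v)"
      using x(1) xpos v \<rho> by (intro norm_le_componentwise_cart) (simp add: mem_box_cart less_imp_le)
    then have "norm x \<le> e / 4" using \<rho> by simp
    then show ?thesis
      using dist_equilibrium_le[of x u "d / \<mu>"] u_gt u_le(1) e by linarith
  qed
  ultimately show ?thesis by blast
qed

section \<open>Steady-state bifurcations\<close>

text \<open>Divide the equilibrium equation by \<open>norm x\<close>: the nonlinear remainder
  becomes \<open>R\<close>, which tends to \<open>0\<close> as \<open>x\<close> does, and the limit
  of the linear part is the kernel equation at \<open>u\<^sub>0\<close>.\<close>

lemma equilibrium_directions_in_kernel:
  fixes B :: "real ^ 'n ^ 'n"
  assumes S: "saturation S" and q: "\<And>n::nat. q n \<in> nonzero_equilibria U (saturated_field S d B)"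
    and lim: "q \<longlonglongrightarrow> (0, u\<^sub>0)" and dir: "(\<lambda>n. fst (q n) /\<^sub>R norm (fst (q n))) \<longlonglongrightarrow> l"
  shows "u\<^sub>0 *\<^sub>R (B *v l) = d *\<^sub>R l"
proof -
  define x where "x n = fst (q n)" for n
  define u where "u n = snd (q n)" for n
  define R where "R y = (map_vec S (B *v y) - B *v y) /\<^sub>R norm y" for y
  have x: "x n \<noteq> 0" "u n *\<^sub>R map_vec S (B *v x n) = d *\<^sub>R x n" for n
    using q[of n] by (auto simp: x_def u_def nonzero_equilibria_def saturated_field_def)
  have x0: "x \<longlonglongrightarrow> 0" and u: "u \<longlonglongrightarrow> u\<^sub>0"
    using tendsto_fst[OF lim] tendsto_snd[OF lim] by (simp_all add: x_def[abs_def] u_def[abs_def])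
  have "(R \<longlongrightarrow> 0) (at 0)"
  proof (rule LIM_I)
    fix r :: real assume r: "0 < r"
    obtain \<eta> where \<eta>: "0 < \<eta>"
      "\<And>y. norm y < \<eta> \<Longrightarrow> norm (map_vec S (B *v y) - B *v y) \<le> (r / 2) * norm y"
      using map_vec_near_identity[OF S, of "r / 2"] r by auto
    show "\<exists>s>0. \<forall>y. y \<noteq> 0 \<and> norm (y - 0) < s \<longrightarrow> norm (R y - 0) < r"
    proof (intro exI[of _ \<eta>] conjI allI impI \<eta>(1))
      fix y :: "real ^ 'n" assume y: "y \<noteq> 0 \<and> norm (y - 0) < \<eta>"
      then have "norm (R y) \<le> r / 2"
        using \<eta>(2)[of y] by (simp add: R_def divide_inverse_commute[symmetric] pos_divide_le_eq)
      then show "norm (R y - 0) < r" using r by simp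
    qed
  qed
  moreover have "filterlim x (at 0) sequentially"
    using x0 x(1) by (simp add: filterlim_at)
  ultimately have Rx: "(\<lambda>n. R (x n)) \<longlonglongrightarrow> 0" by (rule filterlim_compose)
  define z where "z n = x n /\<^sub>R norm (x n)" for n
  have z: "z \<longlonglongrightarrow> l" using dir by (simp add: z_def[abs_def] x_def)
  have "u n *\<^sub>R (B *v z n + R (x n)) = d *\<^sub>R z n" for n
  proof -
    have "B *v z n + R (x n) = map_vec S (B *v x n) /\<^sub>R norm (x n)"
      by (simp add: z_def R_def matrix_vector_mult_scaleR scaleR_diff_right)
    then have "u n *\<^sub>R (B *v z n + R (x n)) = (u n *\<^sub>R map_vec S (B *v x n)) /\<^sub>R norm (x n)"
      by (simp add: mult.commute)
    then show ?thesis by (simp add: x(2) z_def mult.commute)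
  qed
  moreover have "(\<lambda>n. u n *\<^sub>R (B *v z n + R (x n))) \<longlonglongrightarrow> u\<^sub>0 *\<^sub>R (B *v l + 0)"
    by (intro tendsto_intros u Rx bounded_linear.tendsto[OF matrix_vector_mul_bounded_linear z])
  moreover have "(\<lambda>n. d *\<^sub>R z n) \<longlonglongrightarrow> d *\<^sub>R l" by (intro tendsto_intros z)
  ultimately show ?thesis using LIMSEQ_unique by fastforce
qed

lemma steady_state_bifurcation_saturated_field:
  fixes B :: "real ^ 'n ^ 'n"
  assumes S: "saturation S" and "0 < d" "0 < \<mu>" and v: "v \<noteq> 0" "B *v v = \<mu> *\<^sub>R v"
    and near: "\<And>e. 0 < e \<Longrightarrow> \<exists>q\<in>nonzero_equilibria U (saturated_field S d B). dist q (0, d / \<mu>) < e"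
  shows "steady_state_bifurcation U (saturated_field S d B) (d / \<mu>) {x. B *v x = \<mu> *\<^sub>R x}"
proof -
  have ker: "(d / \<mu>) *\<^sub>R (B *v x) = d *\<^sub>R x \<longleftrightarrow> B *v x = \<mu> *\<^sub>R x" for x
  proof -
    have "d *\<^sub>R x = (d / \<mu>) *\<^sub>R (\<mu> *\<^sub>R x)" using assms(3) by simp
    then show ?thesis using assms(2,3) by (metis divide_pos_pos less_irrefl scaleR_cancel_left)
  qed
  show ?thesis
    unfolding steady_state_bifurcation_def
  proof (intro conjI allI impI)
    show "{x. B *v x = \<mu> *\<^sub>R x} \<noteq> {0}" using v by blast
    show "\<exists>J. (saturated_field S d B (d / \<mu>) has_derivative J) (at 0) \<and> {v. J v = 0} = {x. B *v x = \<mu> *\<^sub>R x}"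
      by (intro exI conjI, rule saturated_field_linearization[OF S]) (simp only: ker right_minus_eq)
    show "\<exists>q\<in>nonzero_equilibria U (saturated_field S d B). dist q (0, d / \<mu>) < e" if "0 < e" for e
      using near that by blast
    fix q :: "nat \<Rightarrow> (real ^ 'n) \<times> real" and l
    assume "(\<forall>n. q n \<in> nonzero_equilibria U (saturated_field S d B)) \<and> q \<longlonglongrightarrow> (0, d / \<mu>) \<and>
      (\<lambda>n. fst (q n) /\<^sub>R norm (fst (q n))) \<longlonglongrightarrow> l"
    then have "(d / \<mu>) *\<^sub>R (B *v l) = d *\<^sub>R l"
      by (intro equilibrium_directions_in_kernel[OF S, of q U]) auto
    then show "l \<in> {x. B *v x = \<mu> *\<^sub>R x}" using ker by simp
  qed
qed

text \<open>If \<open>P\<close> failed at equilibria arbitrarily near the bifurcation point, a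
  subsequence of their directions would converge, by compactness of the unit sphere, to a nonzero
  vector of \<open>W\<close>. There \<open>P\<close> holds on a neighbourhood, and scaling carries
  it back to the equilibria.\<close>

lemma branches_emerge_if_open_scaling_property:
  fixes f :: "real \<Rightarrow> 'a::euclidean_space \<Rightarrow> 'a"
  assumes bif: "steady_state_bifurcation U f u\<^sub>0 W"
    and scale: "\<And>x c. 0 < c \<Longrightarrow> P (c *\<^sub>R x) \<Longrightarrow> P x"
    and open_P: "\<And>l. l \<in> W \<Longrightarrow> l \<noteq> 0 \<Longrightarrow> eventually P (nhds l)"
  shows "branches_emerge U f P u\<^sub>0 W"
  unfolding branches_emerge_def
proof (intro conjI bif, rule ccontr)
  assume "\<not> (\<exists>\<epsilon>>0. \<forall>(x, u)\<in>nonzero_equilibria U f. dist (x, u) (0, u\<^sub>0) < \<epsilon> \<longrightarrow> P x)"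
  then have "\<exists>q. q \<in> nonzero_equilibria U f \<and> dist q (0, u\<^sub>0) < inverse (real (Suc n)) \<and> \<not> P (fst q)" for n
    by (fastforce dest: spec[of _ "inverse (real (Suc n))"])
  then obtain q where q: "\<And>n. q n \<in> nonzero_equilibria U f"
    and close: "\<And>n. dist (q n) (0, u\<^sub>0) < inverse (real (Suc n))" and nP: "\<And>n. \<not> P (fst (q n))"
    by metis
  have lim: "q \<longlonglongrightarrow> (0, u\<^sub>0)"
    unfolding tendsto_dist_iff[of q]
    by (rule tendsto_sandwich[OF _ _ tendsto_const LIMSEQ_inverse_real_of_nat])
      (use close in \<open>auto intro!: always_eventually less_imp_le simp del: of_nat_Suc\<close>)
  define z where "z n = fst (q n) /\<^sub>R norm (fst (q n))" for n
  have nz: "fst (q n) \<noteq> 0" for n using q[of n] by (auto simp: nonzero_equilibria_def)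
  have "z n \<in> sphere 0 1" for n using nz[of n] by (simp add: z_def)
  then obtain l r where l: "l \<in> sphere 0 1" and r: "strict_mono r" and zr: "(z \<circ> r) \<longlonglongrightarrow> l"
    using compact_sphere[of 0 1] unfolding compact_def by blast
  have "l \<in> W"
  proof -
    have "(\<forall>n. (q \<circ> r) n \<in> nonzero_equilibria U f) \<and> (q \<circ> r) \<longlonglongrightarrow> (0, u\<^sub>0) \<and>
        (\<lambda>n. fst ((q \<circ> r) n) /\<^sub>R norm (fst ((q \<circ> r) n))) \<longlonglongrightarrow> l"
      using q zr LIMSEQ_subseq_LIMSEQ[OF lim r] by (simp add: z_def comp_def)
    then show ?thesis using bif unfolding steady_state_bifurcation_def by blast
  qed
  moreover have "l \<noteq> 0" using l by auto
  ultimately have "eventually (\<lambda>n. P ((z \<circ> r) n)) sequentially"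
    using open_P zr eventually_compose_filterlim by blast
  then obtain n where "P (z (r n))" by (auto simp: eventually_sequentially)
  then have "P (fst (q (r n)))"
    unfolding z_def by (rule scale[rotated]) (simp add: nz)
  then show False using nP by blast
qed

section \<open>Sign patterns under perturbation and scaling\<close>

lemma eventually_sgn_nth_eq:
  fixes l :: "real ^ 'n"
  shows "eventually (\<lambda>x. \<forall>i. l $ i \<noteq> 0 \<longrightarrow> sgn (x $ i) = sgn (l $ i)) (nhds l)"
proof (rule eventually_all_finite)
  fix i
  have lim: "((\<lambda>x. x $ i) \<longlongrightarrow> l $ i) (nhds l)"
    by (intro tendsto_vec_nth filterlim_ident)
  consider "l $ i = 0" | "0 < l $ i" | "l $ i < 0" by linarith
  then show "eventually (\<lambda>x. l $ i \<noteq> 0 \<longrightarrow> sgn (x $ i) = sgn (l $ i)) (nhds l)"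
  proof cases
    case 2
    then show ?thesis
      using order_tendstoD(1)[OF lim, of 0] by (auto elim: eventually_mono)
  next
    case 3
    then show ?thesis
      using order_tendstoD(2)[OF lim, of 0] by (auto elim: eventually_mono)
  qed simp
qed

lemma agreement_scaleR: "0 < c \<Longrightarrow> agreement (c *\<^sub>R x) \<Longrightarrow> agreement x"
  by (auto simp: agreement_def sgn_mult)

lemma disagreement_scaleR: "0 < c \<Longrightarrow> disagreement (c *\<^sub>R x) \<Longrightarrow> disagreement x"
  by (auto simp: disagreement_def sgn_mult)

lemma eventually_agreement:
  assumes "agreement l"
  shows "eventually agreement (nhds l)"
  using eventually_sgn_nth_eq[of l]
proof (rule eventually_mono)
  fix x :: "real ^ 'a" assume "\<forall>i. l $ i \<noteq> 0 \<longrightarrow> sgn (x $ i) = sgn (l $ i)"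
  then have "sgn (x $ i) = sgn (l $ i)" for i using assms by (simp add: agreement_def)
  then show "agreement x" using assms unfolding agreement_def by (metis sgn_zero_iff)
qed

text \<open>Nonzero entries keep their sign under small perturbations, so one positive and one
  negative entry give an open condition, whatever the other entries do.\<close>

lemma eventually_disagreement:
  assumes "0 < l $ i" "l $ k < 0"
  shows "eventually disagreement (nhds l)"
  using eventually_sgn_nth_eq[of l]
proof (rule eventually_mono)
  fix x :: "real ^ 'a" assume "\<forall>i. l $ i \<noteq> 0 \<longrightarrow> sgn (x $ i) = sgn (l $ i)"
  then have "sgn (x $ i) = 1" "sgn (x $ k) = - 1" "i \<noteq> k" using assms by auto
  then show "disagreement x" unfolding disagreement_def by (metis minus_minus one_neq_zero neg_equal_0_iff_equal)
qed

section \<open>Symmetric saturated fields\<close>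

lemma symmetric_matrix_inner:
  fixes A :: "real ^ 'n ^ 'n"
  assumes "transpose A = A"
  shows "x \<bullet> (A *v y) = (A *v x) \<bullet> y"
  by (metis assms dot_lmul_matrix transpose_matrix_vector)

text \<open>Let \<open>v\<close> minimize the form on the unit sphere, with value \<open>l\<close>.
  Then \<open>x \<bullet> (A *v x) - l * (x \<bullet> x)\<close> is nonnegative everywhere and zero
  at \<open>v\<close>, so \<open>v\<close> is an unconstrained minimum and the derivative there
  vanishes.\<close>

lemma symmetric_matrix_rayleigh_min:
  fixes A :: "real ^ 'n ^ 'n"
  assumes sym: "transpose A = A"
  obtains v l where "v \<noteq> 0" "A *v v = l *\<^sub>R v" "\<And>x. l * (x \<bullet> x) \<le> x \<bullet> (A *v x)"
proof -
  have cont: "continuous_on T (\<lambda>x. x \<bullet> (A *v x))" for T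
    by (intro continuous_intros linear_continuous_on) simp
  obtain k :: 'n where True by blast
  have "axis k 1 \<in> sphere (0 :: real ^ 'n) 1" by simp
  then obtain v where v: "v \<in> sphere 0 1" and min: "\<And>y. y \<in> sphere 0 1 \<Longrightarrow> v \<bullet> (A *v v) \<le> y \<bullet> (A *v y)"
    using continuous_attains_inf[OF compact_sphere _ cont, of 0 1] by blast
  define l where "l = v \<bullet> (A *v v)"
  have vv: "v \<bullet> v = 1" using v by (simp add: norm_eq_1)
  have low: "l * (x \<bullet> x) \<le> x \<bullet> (A *v x)" for x
  proof (cases "x = 0")
    case False
    have "l \<le> (x /\<^sub>R norm x) \<bullet> (A *v (x /\<^sub>R norm x))"
      unfolding l_def using False by (intro min) simp
    also have "\<dots> = (x \<bullet> (A *v x)) / (x \<bullet> x)"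
      by (simp add: matrix_vector_mult_scaleR power2_norm_eq_inner[symmetric] power2_eq_square field_simps)
    finally show ?thesis using False by (simp add: field_simps)
  qed simp
  have "((\<lambda>x. x \<bullet> (A *v x) - l * (x \<bullet> x)) has_derivative
      (\<lambda>h. v \<bullet> (A *v h) + h \<bullet> (A *v v) - l * (v \<bullet> h + h \<bullet> v))) (at v)"
    by (intro derivative_intros bounded_linear.has_derivative[OF matrix_vector_mul_bounded_linear]) 
  then have "(\<lambda>h. v \<bullet> (A *v h) + h \<bullet> (A *v v) - l * (v \<bullet> h + h \<bullet> v)) = (\<lambda>h. 0)"
    by (rule differential_zero_maxmin[of v UNIV, rotated 2]) (use low vv in \<open>auto simp: l_def[symmetric]\<close>)
  then have zero: "v \<bullet> (A *v h) + h \<bullet> (A *v v) - l * (v \<bullet> h + h \<bullet> v) = 0" for h by meson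
  have "2 * ((A *v v - l *\<^sub>R v) \<bullet> h) = 0" for h
    using zero[of h] symmetric_matrix_inner[OF sym, of v h]
    by (simp add: inner_commute[of h] inner_diff_left algebra_simps)
  from this[of "A *v v - l *\<^sub>R v"] have "A *v v = l *\<^sub>R v" by simp
  moreover have "v \<noteq> 0" using v by auto
  ultimately show thesis using that low by blast
qed

text \<open>With \<open>a\<close> and \<open>b\<close> the real and imaginary parts of an
  eigenvector, comparing \<open>a \<bullet> (A *v b)\<close> with
  \<open>(A *v a) \<bullet> b\<close> gives
  \<open>Im m * (a \<bullet> a + b \<bullet> b) = 0\<close>. A nonzero one among \<open>a\<close>
  and \<open>b\<close> is then a real eigenvector.\<close>

lemma symmetric_matrix_complex_eigenvalue:
  fixes A :: "real ^ 'n ^ 'n"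
  assumes sym: "transpose A = A" and m: "complex_eigenvalue A m"
  obtains v where "m \<in> \<real>" "v \<noteq> 0" "A *v v = Re m *\<^sub>R v"
proof -
  obtain z :: "complex ^ 'n" where z: "z \<noteq> 0" "map_matrix complex_of_real A *v z = m *s z"
    using m by (auto simp: complex_eigenvalue_def)
  define a :: "real ^ 'n" where "a = (\<chi> i. Re (z $ i))"
  define b :: "real ^ 'n" where "b = (\<chi> i. Im (z $ i))"
  have comp: "(\<Sum>k\<in>UNIV. complex_of_real (A $ i $ k) * z $ k) = m * z $ i" for i
    using arg_cong[OF z(2), of "\<lambda>x. x $ i"] by (simp add: matrix_vector_mult_def)
  have Aa: "A *v a = Re m *\<^sub>R a - Im m *\<^sub>R b"
    using arg_cong[OF comp, of Re] by (simp add: vec_eq_iff matrix_vector_mult_def a_def b_def)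
  have Ab: "A *v b = Re m *\<^sub>R b + Im m *\<^sub>R a"
    using arg_cong[OF comp, of Im] by (simp add: vec_eq_iff matrix_vector_mult_def a_def b_def)
  have "Im m * (a \<bullet> a + b \<bullet> b) = 0"
    using symmetric_matrix_inner[OF sym, of a b] unfolding Aa Ab
    by (simp add: inner_diff_left inner_add_right algebra_simps)
  moreover have ab: "a \<noteq> 0 \<or> b \<noteq> 0"
    using z(1) by (auto simp: a_def b_def vec_eq_iff complex_eq_iff)
  then have "a \<bullet> a + b \<bullet> b \<noteq> 0"
    by (metis add_nonneg_eq_0_iff inner_eq_zero_iff inner_ge_zero)
  ultimately have "Im m = 0" by simp
  then show thesis
    using that[of a] that[of b] Aa Ab ab by (auto simp: complex_is_Real_iff)
qed

lemma symmetric_matrix_eigenvalue_min_Re: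
  fixes A :: "real ^ 'n ^ 'n"
  assumes sym: "transpose A = A" and m: "eigenvalue_min_Re A m"
  obtains v where "m \<in> \<real>" "v \<noteq> 0" "A *v v = Re m *\<^sub>R v" "\<And>x. Re m * (x \<bullet> x) \<le> x \<bullet> (A *v x)"
proof -
  obtain v where v: "m \<in> \<real>" "v \<noteq> 0" "A *v v = Re m *\<^sub>R v"
    using symmetric_matrix_complex_eigenvalue[OF sym] m by (auto simp: eigenvalue_min_Re_def)
  obtain z l where z: "z \<noteq> 0" "A *v z = l *\<^sub>R z" "\<And>x. l * (x \<bullet> x) \<le> x \<bullet> (A *v x)"
    using symmetric_matrix_rayleigh_min[OF sym] by metis
  have "Re m \<le> l"
    using m complex_eigenvalue_of_real[OF z(2,1)] by (auto simp: eigenvalue_min_Re_def)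
  then have "Re m * (x \<bullet> x) \<le> x \<bullet> (A *v x)" for x
    using z(3)[of x] mult_right_mono[of "Re m" l "x \<bullet> x"] by simp
  then show thesis using that v by blast
qed

lemma symmetric_matrix_generalized_eigenspace:
  fixes A :: "real ^ 'n ^ 'n"
  assumes sym: "transpose A = A"
  shows "generalized_eigenspace A l = {z. A *v z = l *\<^sub>R z}"
proof (rule generalized_eigenspace_eq_eigenspace)
  fix z assume "(A - mat l) *v ((A - mat l) *v z) = 0"
  moreover have "transpose (A - mat l) = A - mat l"
    using sym by (simp add: transpose_def mat_def vec_eq_iff)
  ultimately have "((A - mat l) *v z) \<bullet> ((A - mat l) *v z) = 0"
    using symmetric_matrix_inner[of "A - mat l" z "(A - mat l) *v z"] by simp
  then show "(A - mat l) *v z = 0" by simp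
qed

text \<open>Eigenvectors of distinct eigenvalues are orthogonal, hence independent, so the dimension
  bounds their number. This is used to choose a level off the spectrum.\<close>

lemma symmetric_matrix_finite_eigenvalues:
  fixes A :: "real ^ 'n ^ 'n"
  assumes sym: "transpose A = A"
  shows "finite {l. \<exists>v. v \<noteq> 0 \<and> A *v v = l *\<^sub>R v}"
proof -
  define L where "L = {l. \<exists>v. v \<noteq> 0 \<and> A *v v = l *\<^sub>R v}"
  have "\<forall>l\<in>L. \<exists>v. v \<noteq> 0 \<and> A *v v = l *\<^sub>R v" by (simp add: L_def)
  from bchoice[OF this] obtain e where e: "\<And>l. l \<in> L \<Longrightarrow> e l \<noteq> 0 \<and> A *v e l = l *\<^sub>R e l"
    by blast
  have orth: "e l \<bullet> e k = 0" if "l \<in> L" "k \<in> L" "l \<noteq> k" for l k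
  proof -
    have "(k - l) * (e l \<bullet> e k) = 0"
      using symmetric_matrix_inner[OF sym, of "e l" "e k"] e that by (simp add: algebra_simps)
    then show ?thesis using that by simp
  qed
  have "inj_on e L"
    by (rule inj_onI) (metis e inner_eq_zero_iff orth)
  moreover have "independent (e ` L)"
  proof (rule pairwise_orthogonal_independent)
    show "pairwise orthogonal (e ` L)"
      using orth by (fastforce simp: pairwise_def orthogonal_def)
    show "0 \<notin> e ` L" using e by auto
  qed
  ultimately show ?thesis
    using independent_bound[of "e ` L"] finite_image_iff L_def by blast
qed

section \<open>Stability and instability in the symmetric case\<close>

lemma saturated_field_lipschitz:
  fixes B :: "real ^ 'n ^ 'n"
  assumes S: "saturation S" and "0 < u" "0 < d"
  obtains L where "L-lipschitz_on UNIV (saturated_field S d B u)"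
proof -
  obtain K where K: "K > 0" "\<And>x. norm (B *v x) \<le> norm x * K"
    using bounded_linear.pos_bounded[OF matrix_vector_mul_bounded_linear[of B]] by metis
  have "1-lipschitz_on UNIV (map_vec S :: real ^ 'n \<Rightarrow> _)"
    by (rule lipschitz_onI) (simp_all add: dist_norm norm_map_vec_diff_le[OF S])
  moreover have "K-lipschitz_on UNIV ((*v) B)"
    using K by (intro lipschitz_onI)
      (simp_all add: dist_norm mult.commute flip: matrix_vector_mult_diff_distrib)
  ultimately have "(1 * K)-lipschitz_on UNIV (\<lambda>x. map_vec S (B *v x))"
    by (intro lipschitz_on_compose2) (auto intro: lipschitz_on_subset)
  then have "(\<bar>u\<bar> * (1 * K) + \<bar>d\<bar> * 1)-lipschitz_on UNIV (saturated_field S d B u)"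
    unfolding saturated_field_def by (intro lipschitz_intros)
  then show thesis by (rule that)
qed

lemma saturated_field_stable_symmetric:
  fixes B :: "real ^ 'n ^ 'n"
  assumes S: "saturation S" and upper: "\<And>x. x \<bullet> (B *v x) \<le> \<mu> * (x \<bullet> x)"
    and u: "0 < u" "u * \<mu> < d"
  shows "locally_exponentially_stable (saturated_field S d B u) 0"
proof -
  \<comment> \<open>Half of the gap: \<open>u * (\<mu> + e) - d = - (d - u * \<mu>) / 2\<close>, so
    this decay rate is left once the remainder has been absorbed.\<close>
  define e where "e = (d - u * \<mu>) / (2 * u)"
  have e: "0 < e" using u by (simp add: e_def)
  obtain \<eta> where \<eta>: "0 < \<eta>" "\<And>x. norm x < \<eta> \<Longrightarrow> norm (map_vec S (B *v x) - B *v x) \<le> e * norm x"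
    using map_vec_near_identity[OF S e] by metis
  show ?thesis
  proof (rule locally_exponentially_stable_if_dissipative[where D = "\<lambda>_. 1"])
    show "saturated_field S d B u 0 = 0" by (rule saturated_field_zero[OF S])
    show "0 < (d - u * \<mu>) / 2" using u by simp
    show "0 < \<eta>" by (rule \<eta>)
    fix x :: "real ^ 'n" assume x: "norm x < \<eta>"
    have "x \<bullet> (map_vec S (B *v x) - B *v x) \<le> norm x * (e * norm x)"
      using \<eta>(2)[OF x] norm_cauchy_schwarz by (meson mult_left_mono norm_ge_zero order_trans)
    then have "x \<bullet> map_vec S (B *v x) \<le> (\<mu> + e) * (x \<bullet> x)"
      using upper[of x]
      by (simp add: inner_diff_right algebra_simps flip: power2_norm_eq_inner power2_eq_square)
    then have "u * (x \<bullet> map_vec S (B *v x)) \<le> u * ((\<mu> + e) * (x \<bullet> x))"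
      using u by simp
    moreover have "x \<bullet> saturated_field S d B u x = u * (x \<bullet> map_vec S (B *v x)) - d * (x \<bullet> x)"
      by (simp add: saturated_field_def inner_diff_right)
    moreover have "u * ((\<mu> + e) * (x \<bullet> x)) - d * (x \<bullet> x) = - ((d - u * \<mu>) / 2) * (x \<bullet> x)"
    proof -
      have "u * e = (d - u * \<mu>) / 2" using u by (simp add: e_def)
      then have "u * ((\<mu> + e) * (x \<bullet> x)) = (u * \<mu> + (d - u * \<mu>) / 2) * (x \<bullet> x)"
        by (metis distrib_left mult.assoc)
      then show ?thesis by (simp add: field_simps)
    qed
    ultimately have "x \<bullet> saturated_field S d B u x \<le> - ((d - u * \<mu>) / 2) * (x \<bullet> x)" by linarith
    then show "(\<Sum>i\<in>UNIV. 1 * x $ i * saturated_field S d B u x $ i)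
        \<le> - ((d - u * \<mu>) / 2) * (\<Sum>i\<in>UNIV. 1 * (x $ i)\<^sup>2)"
      by (simp add: inner_vec_def power2_eq_square)
  qed simp
qed

lemma saturated_field_unstable_symmetric:
  fixes B :: "real ^ 'n ^ 'n"
  assumes S: "saturation S" and sym: "transpose B = B" and v: "v \<noteq> 0" "B *v v = \<mu> *\<^sub>R v"
    and "0 < d" and u: "0 < u" "d < u * \<mu>"
  shows "unstable_equilibrium (saturated_field S d B u) 0"
proof -
  \<comment> \<open>Off the spectrum, \<open>P = u (B - l)\<close> is bounded below, which absorbs the nonlinear remainder
    in the derivative of the form \<open>x \<bullet> P x\<close>.\<close>
  have "d / u < \<mu>" using u by (simp add: field_simps)
  then have "infinite {d / u<..<\<mu>}" by (rule infinite_Ioo)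
  then have "\<not> {d / u<..<\<mu>} \<subseteq> {l. \<exists>v. v \<noteq> 0 \<and> B *v v = l *\<^sub>R v}"
    using symmetric_matrix_finite_eigenvalues[OF sym] finite_subset by blast
  then obtain l where "l \<in> {d / u<..<\<mu>}" and nl': "\<nexists>v. v \<noteq> 0 \<and> B *v v = l *\<^sub>R v"
    by blast
  then have l: "d / u < l" "l < \<mu>" by auto
  have nl: "x = 0" if "B *v x = l *\<^sub>R x" for x using nl' that by blast
  \<comment> \<open>The linearization \<open>u B - d\<close> is split as \<open>P + c\<close>, so
    along the field it contributes \<open>c * (x \<bullet> (P *v x))\<close> and the square
    \<open>(norm (P *v x))\<^sup>2\<close>.\<close>
  define c where "c = u * l - d"
  have c: "0 < c" using l u by (simp add: c_def field_simps)
  define P where "P = mat (- (u * l)) + u *\<^sub>R B"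
  have P: "P *v x = u *\<^sub>R (B *v x) - (u * l) *\<^sub>R x" for x
    by (simp add: P_def shifted_matrix_vector_mult)
  have "inj ((*v) P)"
  proof (subst linear_injective_0, simp, intro allI impI)
    fix x assume "P *v x = 0"
    then have "u *\<^sub>R (B *v x) = u *\<^sub>R (l *\<^sub>R x)" by (simp add: P)
    then have "B *v x = l *\<^sub>R x" using scaleR_left_imp_eq[of u] u(1) by blast
    then show "x = 0" by (rule nl)
  qed
  then obtain k where k: "0 < k" "\<And>x. k * norm x \<le> norm (P *v x)"
    using linear_inj_bounded_below_pos[OF matrix_vector_mul_linear] by blast
  \<comment> \<open>With the tolerance \<open>k / u\<close>, \<open>u\<close> times the remainder
    has norm at most \<open>k * norm x \<le> norm (P *v x)\<close>, so the square of
    \<open>norm (P *v x)\<close> pays for it.\<close>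
  obtain \<eta> where \<eta>: "0 < \<eta>" "\<And>x. norm x < \<eta> \<Longrightarrow> norm (map_vec S (B *v x) - B *v x) \<le> (k / u) * norm x"
    using map_vec_near_identity[OF S, of "k / u"] k u by auto
  obtain L where L: "L-lipschitz_on UNIV (saturated_field S d B u)"
    using saturated_field_lipschitz[OF S u(1) \<open>0 < d\<close>] by metis
  show ?thesis
  proof (rule unstable_if_quadratic_form_expands[OF _ L _ c \<eta>(1)])
    show "saturated_field S d B u 0 = 0" by (rule saturated_field_zero[OF S])
    show "x \<bullet> (P *v y) = (P *v x) \<bullet> y" for x y
      using symmetric_matrix_inner[OF sym, of x y] by (simp add: P inner_diff_left inner_diff_right)
    have "v \<bullet> (P *v v) = u * (\<mu> - l) * (v \<bullet> v)"
      by (simp add: P v algebra_simps)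
    then show "0 < v \<bullet> (P *v v)" using u l v by simp
    fix x :: "real ^ 'n" assume x: "norm x < \<eta>"
    define r where "r = map_vec S (B *v x) - B *v x"
    have "saturated_field S d B u x = P *v x + c *\<^sub>R x + u *\<^sub>R r"
      by (simp add: saturated_field_def P c_def r_def algebra_simps)
    then have eq: "(P *v x) \<bullet> saturated_field S d B u x
        = (norm (P *v x))\<^sup>2 + c * (x \<bullet> (P *v x)) + u * ((P *v x) \<bullet> r)"
      by (simp add: inner_add_right power2_norm_eq_inner inner_commute)
    have "- ((P *v x) \<bullet> r) \<le> norm (P *v x) * norm r"
      using norm_cauchy_schwarz[of "P *v x" "- r"] by simp
    also have "\<dots> \<le> norm (P *v x) * (k / u * norm x)"
      using \<eta>(2)[OF x] by (intro mult_left_mono) (auto simp: r_def)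
    finally have "u * (- ((P *v x) \<bullet> r)) \<le> u * (norm (P *v x) * (k / u * norm x))"
      using u(1) by (intro mult_left_mono) auto
    also have "\<dots> = norm (P *v x) * (k * norm x)" using u(1) by simp
    also have "\<dots> \<le> norm (P *v x) * norm (P *v x)"
      by (rule mult_left_mono[OF k(2) norm_ge_zero])
    finally show "c * (x \<bullet> (P *v x)) \<le> (P *v x) \<bullet> saturated_field S d B u x"
      unfolding eq by (simp add: power2_eq_square)
  qed
qed

text \<open>\<open>g\<close> is an antiderivative of \<open>z * S' z\<close> taken on
  \<open>{-1..1}\<close>, whence the window. \<open>g z - (S z)\<^sup>2 / 2\<close> and
  \<open>z\<^sup>2 / 2 - g z\<close> vanish at \<open>0\<close> and have derivatives
  \<open>(z - S z) * S' z\<close> and \<open>z * (1 - S' z)\<close>, which carry the sign of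
  \<open>z\<close>, the first one strictly.\<close>

lemma saturation_potential:
  assumes "saturation S"
  obtains g S' where "\<And>z. (S has_real_derivative S' z) (at z)" "\<And>z. 0 < S' z" "g 0 = 0"
    "\<And>z. \<bar>z\<bar> < 1 \<Longrightarrow> (g has_real_derivative z * S' z) (at z)"
    "\<And>z. \<bar>z\<bar> < 1 \<Longrightarrow> z \<noteq> 0 \<Longrightarrow> (S z)\<^sup>2 / 2 < g z"
    "\<And>z. \<bar>z\<bar> < 1 \<Longrightarrow> g z \<le> z\<^sup>2 / 2"
proof -
  obtain S' where S': "\<And>z. (S has_real_derivative S' z) (at z)" and contS': "continuous_on UNIV S'"
    and pos: "\<And>z. 0 < S' z" and le1: "\<And>z. S' z \<le> 1"
    using saturation_derivative[OF assms] by metis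
  have "continuous_on {-1..1} (\<lambda>z. z * S' z)"
    by (intro continuous_intros continuous_on_subset[OF contS']) auto
  then obtain G where G: "\<And>z. z \<in> {-1..1} \<Longrightarrow>
      (G has_vector_derivative z * S' z) (at z within {-1..1})"
    using antiderivative_continuous by blast
  define g where "g z = G z - G 0" for z
  have g: "(g has_real_derivative z * S' z) (at z)" if "\<bar>z\<bar> < 1" for z
  proof -
    have "at z within {-1..1} = at z" using that by (intro at_within_Icc_at) auto
    moreover have "z \<in> {-1..1}" using that by auto
    ultimately have "(G has_real_derivative z * S' z) (at z)"
      using G[of z] by (simp add: has_real_derivative_iff_has_vector_derivative)
    then show ?thesis unfolding g_def by (auto intro!: derivative_eq_intros)
  qed
  have g0: "g 0 = 0" by (simp add: g_def)
  define k where "k z = g z - (S z)\<^sup>2 / 2" for z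
  have k: "(k has_real_derivative (z - S z) * S' z) (at z)" if "\<bar>z\<bar> < 1" for z
    unfolding k_def
    by (auto intro!: derivative_eq_intros g[OF that] S' simp: algebra_simps)
  have k0: "k 0 = 0" by (simp add: k_def g0 saturation_zero[OF assms])
  have contk: "continuous_on {a..b} k" if "-1 < a" "b < 1" for a b
    using k that by (intro continuous_at_imp_continuous_on ballI DERIV_isCont[OF k]) auto
  have kpos: "0 < k z" if z: "\<bar>z\<bar> < 1" "z \<noteq> 0" for z
  proof (cases "0 < z")
    case True
    have "k 0 < k z"
    proof (rule DERIV_pos_imp_increasing_open[OF True])
      show "\<exists>y. (k has_real_derivative y) (at x) \<and> 0 < y" if "0 < x" "x < z" for x
        using k[of x] z that pos[of x] saturation_less[OF assms, of x]
        by (intro exI[of _ "(x - S x) * S' x"]) auto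
    qed (use z contk in auto)
    then show ?thesis by (simp add: k0)
  next
    case False
    then have neg: "z < 0" using z by simp
    have "k z > k 0"
    proof (rule DERIV_neg_imp_decreasing_open[OF neg])
      show "\<exists>y. (k has_real_derivative y) (at x) \<and> y < 0" if "z < x" "x < 0" for x
        using k[of x] z that pos[of x] saturation_less[OF assms, of "- x"]
        by (intro exI[of _ "(x - S x) * S' x"])
          (auto simp: saturation_minus[OF assms] mult_neg_pos)
    qed (use z contk in auto)
    then show ?thesis by (simp add: k0)
  qed
  define m where "m z = z\<^sup>2 / 2 - g z" for z
  have m: "(m has_real_derivative z * (1 - S' z)) (at z)" if "\<bar>z\<bar> < 1" for z
    unfolding m_def by (auto intro!: derivative_eq_intros g[OF that] simp: algebra_simps)
  have m0: "m 0 = 0" by (simp add: m_def g0)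
  have mnn: "0 \<le> m z" if z: "\<bar>z\<bar> < 1" for z
  proof (cases "0 \<le> z")
    case True
    have "m 0 \<le> m z"
    proof (rule DERIV_nonneg_imp_nondecreasing[OF True])
      show "\<exists>y. (m has_real_derivative y) (at x) \<and> 0 \<le> y" if "0 \<le> x" "x \<le> z" for x
        using m[of x] z that le1[of x] by (intro exI[of _ "x * (1 - S' x)"]) auto
    qed
    then show ?thesis by (simp add: m0)
  next
    case False
    then have "z \<le> 0" by simp
    then have "m z \<ge> m 0"
    proof (rule DERIV_nonpos_imp_nonincreasing)
      show "\<exists>y. (m has_real_derivative y) (at x) \<and> y \<le> 0" if "z \<le> x" "x \<le> 0" for x
        using m[of x] z that le1[of x]
        by (intro exI[of _ "x * (1 - S' x)"]) (auto simp: mult_nonpos_nonneg)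
    qed
    then show ?thesis by (simp add: m0)
  qed
  show thesis
    using that[OF S' pos g0 g] kpos mnn by (simp add: k_def m_def)
qed

text \<open>Nonzero equilibria correspond to critical points of
  \<open>y \<mapsto> S(y) \<bullet> B S(y) / 2 - \<kappa> \<Sum>\<^sub>i g(y\<^sub>i)\<close> with \<open>g'(z) = z S'(z)\<close> and \<open>\<kappa> = d / u\<close>, through
  \<open>x = S(y) / \<kappa>\<close>. For \<open>\<kappa>\<close> slightly below \<open>\<mu>\<close> this function is negative on a small sphere but
  positive at some point inside, so it has a nonzero interior maximum, whatever the multiplicity
  of \<open>\<mu>\<close>.\<close>

lemma equilibria_near_bifurcation_symmetric:
  fixes B :: "real ^ 'n ^ 'n"
  assumes S: "saturation S" and sym: "transpose B = B"
    and upper: "\<And>x. x \<bullet> (B *v x) \<le> \<mu> * (x \<bullet> x)"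
    and v: "v \<noteq> 0" "B *v v = \<mu> *\<^sub>R v" and \<mu>: "0 < \<mu>" and "0 < d" and e: "0 < e"
  shows "\<exists>q\<in>nonzero_equilibria {0..} (saturated_field S d B). dist q (0, d / \<mu>) < e"
proof -
  obtain g S' where S': "\<And>z. (S has_real_derivative S' z) (at z)" and S'pos: "\<And>z. 0 < S' z"
    and g0: "g 0 = 0" and g: "\<And>z. \<bar>z\<bar> < 1 \<Longrightarrow> (g has_real_derivative z * S' z) (at z)"
    and g_gt: "\<And>z. \<bar>z\<bar> < 1 \<Longrightarrow> z \<noteq> 0 \<Longrightarrow> (S z)\<^sup>2 / 2 < g z"
    and g_le: "\<And>z. \<bar>z\<bar> < 1 \<Longrightarrow> g z \<le> z\<^sup>2 / 2"
    using saturation_potential[OF S] by metis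
  \<comment> \<open>\<open>1 / 2\<close> keeps all components in the window of \<open>g\<close>;
    \<open>\<mu> * e / 8\<close> gives \<open>norm x \<le> \<rho> / \<kappa> \<le> e / 4\<close> for
    the equilibrium found at the end, since \<open>\<kappa> > \<mu> / 2\<close>.\<close>
  define \<rho> where "\<rho> = min (1 / 2) (\<mu> * e / 8)"
  have \<rho>: "0 < \<rho>" "\<rho> < 1" "\<rho> \<le> \<mu> * e / 8" using \<mu> e by (auto simp: \<rho>_def)
  have comp1: "\<bar>y $ i\<bar> < 1" if "norm y \<le> \<rho>" for y :: "real ^ 'n" and i
    using component_le_norm_cart[of y i] that \<rho> by linarith
  define Q where "Q y = map_vec S y \<bullet> (B *v map_vec S y)" for y
  define \<Gamma> where "\<Gamma> y = (\<Sum>i\<in>UNIV. g (y $ i))" for y :: "real ^ 'n"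
  define H where "H \<kappa> y = Q y / 2 - \<kappa> * \<Gamma> y" for \<kappa> y
  \<comment> \<open>\<open>N\<close> is the excess of \<open>\<Gamma>\<close> over half of the
    squared norm of \<open>map_vec S y\<close>. Its positive lower bound \<open>n0\<close> on the
    sphere gives \<open>H \<mu> y \<le> - \<mu> * n0\<close> there, a margin that survives lowering
    \<open>\<kappa>\<close> a little below \<open>\<mu>\<close>.\<close>
  define N where "N y = (\<Sum>i\<in>UNIV. g (y $ i) - (S (y $ i))\<^sup>2 / 2)" for y :: "real ^ 'n"
  have normsq: "(norm x)\<^sup>2 = (\<Sum>i\<in>UNIV. (x $ i)\<^sup>2)" for x :: "real ^ 'n"
    unfolding power2_norm_eq_inner inner_vec_def by (simp add: power2_eq_square)
  have contg: "continuous_on (cball 0 \<rho>) (\<lambda>y :: real ^ 'n. g (y $ i))" for i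
  proof (rule continuous_on_compose2[of "{-1<..<1}" g])
    show "continuous_on {-1<..<1} g"
      using g by (intro continuous_at_imp_continuous_on ballI DERIV_isCont[OF g]) auto
    show "(\<lambda>y :: real ^ 'n. y $ i) ` cball 0 \<rho> \<subseteq> {-1<..<1}"
      using comp1 by (auto simp: abs_less_iff minus_less_iff)
  qed (intro continuous_intros)
  have contS: "continuous_on T (\<lambda>y :: real ^ 'n. S (y $ i))" for T i
    by (rule continuous_on_compose2[OF saturation_continuous[OF S, of UNIV]]) (auto intro!: continuous_intros)
  have contQ: "continuous_on T Q" for T
    unfolding Q_def map_vec_def
    by (intro continuous_intros contS continuous_on_compose2[OF linear_continuous_on[of "(*v) B" UNIV]]) auto
  have contH: "continuous_on (cball 0 \<rho>) (H \<kappa>)" for \<kappa>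
    unfolding H_def \<Gamma>_def by (intro continuous_intros contQ contg) auto
  have contN: "continuous_on (sphere 0 \<rho>) N"
    unfolding N_def
    by (intro continuous_intros contS continuous_on_subset[OF contg]) auto
  have Npos: "0 < N y" if "y \<in> sphere 0 \<rho>" for y
  proof -
    have ny: "norm y = \<rho>" using that by simp
    then have "y \<noteq> 0" using \<rho> by auto
    then obtain i where "y $ i \<noteq> 0" by (auto simp: vec_eq_iff)
    then have i: "0 < g (y $ i) - (S (y $ i))\<^sup>2 / 2" using g_gt[of "y $ i"] comp1[of y i] ny by simp
    have "0 \<le> g (y $ j) - (S (y $ j))\<^sup>2 / 2" for j
      using g_gt[of "y $ j"] comp1[of y j] ny g0 saturation_zero[OF S] by (cases "y $ j = 0") auto
    then show ?thesis unfolding N_def using i by (intro sum_pos2[of UNIV i]) auto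
  qed
  have "(v /\<^sub>R norm v) \<in> sphere 0 1" using v by simp
  then have "\<rho> *\<^sub>R (v /\<^sub>R norm v) \<in> sphere 0 \<rho>" using \<rho> v by simp
  then obtain n0 where n0: "0 < n0" "\<And>y. y \<in> sphere 0 \<rho> \<Longrightarrow> n0 \<le> N y"
    using continuous_attains_inf[OF compact_sphere _ contN] Npos by blast
  have \<Gamma>_le: "\<Gamma> y \<le> (norm y)\<^sup>2 / 2" if "norm y \<le> \<rho>" for y
    unfolding \<Gamma>_def normsq sum_divide_distrib by (intro sum_mono g_le comp1 that)
  \<comment> \<open>The third condition keeps the cost
    \<open>(\<mu> - \<kappa>) * \<Gamma> y\<close> of lowering \<open>\<kappa>\<close> within the
    margin on the sphere; the fourth brings the attention \<open>d / \<kappa>\<close> close to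
    \<open>d / \<mu>\<close>.\<close>
  obtain \<kappa> where \<kappa>: "\<kappa> < \<mu>" "\<mu> / 2 < \<kappa>" "(\<mu> - \<kappa>) * (\<rho>\<^sup>2 / 2) < \<mu> * n0" "\<bar>d / \<kappa> - d / \<mu>\<bar> < e / 2"
  proof -
    have "((\<lambda>\<kappa>. (\<mu> - \<kappa>) * (\<rho>\<^sup>2 / 2)) \<longlongrightarrow> (\<mu> - \<mu>) * (\<rho>\<^sup>2 / 2)) (at_left \<mu>)"
      by (intro tendsto_intros)
    then have "eventually (\<lambda>\<kappa>. (\<mu> - \<kappa>) * (\<rho>\<^sup>2 / 2) < \<mu> * n0) (at_left \<mu>)"
      using \<mu> n0 by (intro order_tendstoD) auto
    moreover have "((\<lambda>\<kappa>. d / \<kappa>) \<longlongrightarrow> d / \<mu>) (at_left \<mu>)"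
      using \<mu> by (intro tendsto_intros) auto
    then have "eventually (\<lambda>\<kappa>. dist (d / \<kappa>) (d / \<mu>) < e / 2) (at_left \<mu>)"
      using e by (intro tendstoD) auto
    moreover have "eventually (\<lambda>\<kappa>. \<kappa> \<in> {\<mu> / 2<..<\<mu>}) (at_left \<mu>)"
      using \<mu> by (intro eventually_at_leftI[of "\<mu> / 2"]) auto
    ultimately have "eventually (\<lambda>\<kappa>. \<kappa> < \<mu> \<and> \<mu> / 2 < \<kappa> \<and> (\<mu> - \<kappa>) * (\<rho>\<^sup>2 / 2) < \<mu> * n0 \<and>
        \<bar>d / \<kappa> - d / \<mu>\<bar> < e / 2) (at_left \<mu>)"
      by eventually_elim (auto simp: dist_real_def)
    then show thesis using that eventually_happens'[OF trivial_limit_at_left_real] by blast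
  qed
  have \<kappa>pos: "0 < \<kappa>" using \<kappa> \<mu> by linarith
  have Hneg: "H \<kappa> y < 0" if "y \<in> sphere 0 \<rho>" for y
  proof -
    have ny: "norm y = \<rho>" using that by simp
    have "Q y \<le> \<mu> * (\<Sum>i\<in>UNIV. (S (y $ i))\<^sup>2)"
      using upper[of "map_vec S y"] by (simp add: Q_def inner_vec_def power2_eq_square)
    moreover have "N y = \<Gamma> y - (\<Sum>i\<in>UNIV. (S (y $ i))\<^sup>2) / 2"
      by (simp add: N_def \<Gamma>_def sum_subtractf sum_divide_distrib)
    ultimately have "Q y / 2 \<le> \<mu> * (\<Gamma> y - N y)" by simp
    then have "H \<kappa> y \<le> (\<mu> - \<kappa>) * \<Gamma> y - \<mu> * N y"
      by (simp add: H_def algebra_simps)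
    also have "\<dots> \<le> (\<mu> - \<kappa>) * (\<rho>\<^sup>2 / 2) - \<mu> * n0"
      using \<Gamma>_le[of y] ny \<kappa> \<mu> n0(2)[OF that]
      by (intro diff_mono mult_left_mono) auto
    finally show ?thesis using \<kappa> by linarith
  qed
  \<comment> \<open>\<open>Q (t *\<^sub>R v) / t\<^sup>2\<close> tends to
    \<open>\<mu> * (v \<bullet> v)\<close>, which exceeds \<open>\<kappa> * (v \<bullet> v)\<close>,
    while \<open>\<Gamma>\<close> is at most half of the squared norm. So \<open>H \<kappa>\<close>
    is positive at small nonzero multiples of \<open>v\<close>.\<close>
  obtain t where t: "t \<noteq> 0" "norm (t *\<^sub>R v) \<le> \<rho>" "\<kappa> * (v \<bullet> v) < Q (t *\<^sub>R v) / t\<^sup>2"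
  proof -
    define p where "p t = (\<chi> i. S (t * v $ i) / t)" for t
    have "((\<lambda>t. S (t * a) / t) \<longlongrightarrow> a) (at 0)" for a
    proof -
      have S1: "S' 0 = 1"
        using saturation_derivative[OF S] S' DERIV_unique by metis
      have "((\<lambda>t. S (t * a)) has_real_derivative S' (0 * a) * a) (at 0)"
        by (rule DERIV_chain2[OF S']) (auto intro!: derivative_eq_intros)
      then show ?thesis by (simp add: DERIV_def S1 saturation_zero[OF S])
    qed
    then have "(p \<longlongrightarrow> (\<chi> i. v $ i)) (at 0)"
      unfolding p_def by (intro tendsto_intros)
    then have p: "(p \<longlongrightarrow> v) (at 0)" by simp
    have "((\<lambda>t. p t \<bullet> (B *v p t)) \<longlongrightarrow> v \<bullet> (B *v v)) (at 0)"
      by (intro tendsto_intros p bounded_linear.tendsto[OF matrix_vector_mul_bounded_linear p])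
    moreover have "\<kappa> * (v \<bullet> v) < v \<bullet> (B *v v)" using \<kappa> v by simp
    ultimately have "eventually (\<lambda>t. \<kappa> * (v \<bullet> v) < p t \<bullet> (B *v p t)) (at 0)"
      by (rule order_tendstoD(1))
    moreover have "((\<lambda>t. norm (t *\<^sub>R v)) \<longlongrightarrow> norm (0 *\<^sub>R v)) (at 0)"
      by (intro tendsto_intros)
    then have "eventually (\<lambda>t. norm (t *\<^sub>R v) < \<rho>) (at 0)"
      using \<rho> by (intro order_tendstoD(2)) auto
    moreover have "eventually (\<lambda>t::real. t \<noteq> 0) (at 0)"
      by (simp add: eventually_at_filter)
    ultimately have "eventually (\<lambda>t. t \<noteq> 0 \<and> norm (t *\<^sub>R v) \<le> \<rho> \<and> \<kappa> * (v \<bullet> v) < p t \<bullet> (B *v p t)) (at 0)"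
      by eventually_elim auto
    then obtain t where t: "t \<noteq> 0" "norm (t *\<^sub>R v) \<le> \<rho>" "\<kappa> * (v \<bullet> v) < p t \<bullet> (B *v p t)"
      using eventually_happens'[OF at_neq_bot] by blast
    have "map_vec S (t *\<^sub>R v) = t *\<^sub>R p t" using t by (simp add: vec_eq_iff p_def)
    then have "Q (t *\<^sub>R v) / t\<^sup>2 = p t \<bullet> (B *v p t)"
      using t by (simp add: Q_def matrix_vector_mult_scaleR power2_eq_square)
    then show thesis using that t by simp
  qed
  have Hpos: "0 < H \<kappa> (t *\<^sub>R v)"
  proof -
    have "\<kappa> * \<Gamma> (t *\<^sub>R v) \<le> \<kappa> * ((norm (t *\<^sub>R v))\<^sup>2 / 2)"
      using \<Gamma>_le[OF t(2)] \<kappa>pos by (intro mult_left_mono) auto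
    also have "\<dots> = \<kappa> * (v \<bullet> v) * t\<^sup>2 / 2"
      by (simp add: power_mult_distrib power2_norm_eq_inner[symmetric])
    also have "\<dots> < Q (t *\<^sub>R v) / 2"
      using t by (simp add: pos_less_divide_eq)
    finally show ?thesis by (simp add: H_def)
  qed
  have "cball (0 :: real ^ 'n) \<rho> \<noteq> {}" using \<rho> by simp
  then obtain y where y: "y \<in> cball 0 \<rho>" and max: "\<And>z. z \<in> cball 0 \<rho> \<Longrightarrow> H \<kappa> z \<le> H \<kappa> y"
    using continuous_attains_sup[OF compact_cball _ contH[of \<kappa>]] by blast
  have Hy: "0 < H \<kappa> y" using max[of "t *\<^sub>R v"] t Hpos by simp
  have ny: "norm y < \<rho>" using y Hneg[of y] Hy by (cases "norm y = \<rho>") auto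
  have "H \<kappa> 0 = 0"
    by (simp add: H_def Q_def \<Gamma>_def g0 map_vec_zero[OF S])
  then have "y \<noteq> 0" using Hy by auto
  \<comment> \<open>The interior maximum is tested along one axis at a time: moving
    \<open>y $ i\<close> changes only one entry of \<open>map_vec S y\<close>, and the derivative is
    \<open>S' (y $ i) * ((B *v map_vec S y) $ i - \<kappa> * y $ i)\<close>, whose first factor is
    positive.\<close>
  have crit: "B *v map_vec S y = \<kappa> *\<^sub>R y"
  proof -
    have "(B *v map_vec S y) $ i = \<kappa> * y $ i" for i
    proof -
      define b where "b = (B *v map_vec S y) $ i"
      define a where "a s = S (y $ i + s) - S (y $ i)" for s
      define E where "E = axis i (1::real)"
      have mapE: "map_vec S (y + s *\<^sub>R E) = map_vec S y + a s *\<^sub>R E" for s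
        by (simp add: vec_eq_iff E_def a_def axis_def)
      have "E \<bullet> (B *v map_vec S y) = b" "map_vec S y \<bullet> (B *v E) = b"
        using symmetric_matrix_inner[OF sym, of "map_vec S y" E]
        by (simp_all add: E_def b_def inner_axis inner_axis')
      then have Qs: "Q (y + s *\<^sub>R E) = Q y + 2 * a s * b + (a s)\<^sup>2 * (E \<bullet> (B *v E))" for s
        by (simp add: Q_def mapE matrix_vector_right_distrib matrix_vector_mult_scaleR
            inner_add_left inner_add_right algebra_simps power2_eq_square)
      have \<Gamma>s: "\<Gamma> (y + s *\<^sub>R E) = (\<Sum>j\<in>UNIV - {i}. g (y $ j)) + g (y $ i + s)" for s
      proof -
        have "\<Gamma> (y + s *\<^sub>R E) = g ((y + s *\<^sub>R E) $ i) + (\<Sum>j\<in>UNIV - {i}. g ((y + s *\<^sub>R E) $ j))"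
          unfolding \<Gamma>_def by (rule sum.remove) auto
        also have "(\<Sum>j\<in>UNIV - {i}. g ((y + s *\<^sub>R E) $ j)) = (\<Sum>j\<in>UNIV - {i}. g (y $ j))"
          by (rule sum.cong) (auto simp: E_def axis_def)
        finally show ?thesis by (simp add: E_def axis_def)
      qed
      have da: "(a has_real_derivative S' (y $ i)) (at 0)"
        unfolding a_def
        using DERIV_shift[of S "S' (y $ i)" 0 "y $ i"] S'[of "y $ i"]
        by (auto intro!: derivative_eq_intros simp: add.commute)
      have dg: "((\<lambda>s. g (y $ i + s)) has_real_derivative y $ i * S' (y $ i)) (at 0)"
        using DERIV_shift[of g "y $ i * S' (y $ i)" 0 "y $ i"] g[OF comp1[of y i]] ny
        by (simp add: add.commute)
      have a0: "a 0 = 0" by (simp add: a_def)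
      have "((\<lambda>s. H \<kappa> (y + s *\<^sub>R E)) has_real_derivative
          S' (y $ i) * b - \<kappa> * (y $ i * S' (y $ i))) (at 0)"
        unfolding H_def Qs \<Gamma>s
        by (auto intro!: derivative_eq_intros da dg simp: a0)
      then have "S' (y $ i) * b - \<kappa> * (y $ i * S' (y $ i)) = 0"
      proof (rule DERIV_local_max)
        show "0 < \<rho> - norm y" using ny by simp
        show "\<forall>s. \<bar>0 - s\<bar> < \<rho> - norm y \<longrightarrow> H \<kappa> (y + s *\<^sub>R E) \<le> H \<kappa> (y + 0 *\<^sub>R E)"
        proof (intro allI impI)
          fix s :: real assume "\<bar>0 - s\<bar> < \<rho> - norm y"
          then have "norm (y + s *\<^sub>R E) \<le> \<rho>"
            using norm_triangle_ineq[of y "s *\<^sub>R E"] by (simp add: E_def)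
          then show "H \<kappa> (y + s *\<^sub>R E) \<le> H \<kappa> (y + 0 *\<^sub>R E)" using max by simp
        qed
      qed
      then have "S' (y $ i) * (b - \<kappa> * y $ i) = 0" by (simp add: algebra_simps)
      then show ?thesis using S'pos[of "y $ i"] by (simp add: b_def)
    qed
    then show ?thesis by (simp add: vec_eq_iff)
  qed
  define x where "x = map_vec S y /\<^sub>R \<kappa>"
  have Bx: "B *v x = y" using \<kappa>pos by (simp add: x_def matrix_vector_mult_scaleR crit)
  have "x \<noteq> 0" using Bx \<open>y \<noteq> 0\<close> by auto
  moreover have "saturated_field S d B (d / \<kappa>) x = 0"
    by (simp add: saturated_field_def Bx) (simp add: x_def divide_inverse)
  ultimately have "(x, d / \<kappa>) \<in> nonzero_equilibria {0..} (saturated_field S d B)"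
    using \<kappa>pos \<open>0 < d\<close> by (simp add: nonzero_equilibria_def)
  moreover have "dist (x, d / \<kappa>) (0, d / \<mu>) < e"
  proof -
    have "norm (map_vec S y) \<le> norm y"
      by (rule norm_le_componentwise_cart) (simp add: saturation_abs_le[OF S])
    moreover have "\<kappa> * norm x = norm (map_vec S y)" using \<kappa>pos by (simp add: x_def field_simps)
    ultimately have "\<kappa> * norm x \<le> \<rho>" using ny by simp
    then have "\<mu> / 2 * norm x \<le> \<mu> * e / 8"
      using \<kappa>(2) \<rho>(3) mult_right_mono[OF less_imp_le[OF \<kappa>(2)] norm_ge_zero[of x]] by linarith
    then have "norm x \<le> e / 4" using \<mu> by (simp add: field_simps)
    then show ?thesis
      using dist_equilibrium_le[of x "d / \<kappa>" "d / \<mu>"] \<kappa>(4) e by linarith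
  qed
  ultimately show ?thesis by blast
qed

section \<open>Adjacency matrices\<close>

lemma adjacency_matrix_nonneg: "0 \<le> adjacency_matrix E $ i $ k"
  by (simp add: adjacency_matrix_def)

lemma irreducible_adjacency_matrix:
  assumes "\<And>i k. (i, k) \<in> E\<^sup>*"
  shows "irreducible_nonneg_matrix (adjacency_matrix E)"
proof -
  have "{(i, k). 0 < adjacency_matrix E $ i $ k} = E" by (auto simp: adjacency_matrix_def)
  then show ?thesis
    using assms by (simp add: irreducible_nonneg_matrix_def adjacency_matrix_nonneg)
qed

lemma transpose_adjacency_matrix:
  assumes "sym E"
  shows "transpose (adjacency_matrix E) = adjacency_matrix E"
  using assms by (auto simp: transpose_def adjacency_matrix_def vec_eq_iff sym_def)

lemma transpose_shifted_matrix:
  fixes A :: "real ^ 'n ^ 'n"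
  shows "transpose (mat \<alpha> + \<gamma> *\<^sub>R A) = mat \<alpha> + \<gamma> *\<^sub>R transpose A"
  by (simp add: transpose_def mat_def vec_eq_iff)

lemma shifted_matrix_eigenvector_iff:
  fixes A :: "real ^ 'n ^ 'n"
  assumes "\<gamma> \<noteq> 0"
  shows "(mat \<alpha> + \<gamma> *\<^sub>R A) *v x = (\<alpha> + \<gamma> * l) *\<^sub>R x \<longleftrightarrow> A *v x = l *\<^sub>R x"
proof -
  have "(mat \<alpha> + \<gamma> *\<^sub>R A) *v x = (\<alpha> + \<gamma> * l) *\<^sub>R x \<longleftrightarrow> \<gamma> *\<^sub>R (A *v x) = \<gamma> *\<^sub>R (l *\<^sub>R x)"
    by (simp add: shifted_matrix_vector_mult scaleR_add_left)
  then show ?thesis using assms by (simp only: scaleR_cancel_left) simp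
qed

text \<open>Were all entries nonpositive, \<open>A *v z\<close> would be nonpositive while
  \<open>l *\<^sub>R z\<close> is nonnegative, which forces \<open>z = 0\<close>. Applied to
  \<open>z\<close> and \<open>- z\<close> it yields entries of both signs, that is,
  disagreement.\<close>

lemma nonneg_matrix_negative_eigenvector_pos_entry:
  fixes A :: "real ^ 'n ^ 'n"
  assumes nn: "\<And>i k. 0 \<le> A $ i $ k" and z: "A *v z = l *\<^sub>R z" "z \<noteq> 0" and l: "l < 0"
  obtains i where "0 < z $ i"
proof (rule ccontr)
  assume "\<not> thesis"
  then have "\<not> 0 < z $ i" for i using that by blast
  then have le: "z $ i \<le> 0" for i by (simp add: not_less)
  have "z $ i = 0" for i
  proof -
    have "l * z $ i = (\<Sum>k\<in>UNIV. A $ i $ k * z $ k)"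
      using arg_cong[OF z(1), of "\<lambda>x. x $ i"] by (simp add: matrix_vector_mult_def)
    also have "\<dots> \<le> 0" using nn le by (intro sum_nonpos mult_nonneg_nonpos)
    finally show ?thesis using l le[of i] by (simp add: mult_le_0_iff)
  qed
  then show False using z(2) by (simp add: vec_eq_iff)
qed

text \<open>The difference of the two basis vectors at the ends of an edge has form value
  \<open>- 2\<close> and squared norm \<open>2\<close>. It shows that the smallest eigenvalue is
  negative, so that \<open>\<mu>\<close> is positive for \<open>\<gamma> < 0\<close>.\<close>

lemma adjacency_matrix_negative_form:
  fixes E :: "('n::finite \<times> 'n) set"
  assumes "irrefl E" "sym E" "\<And>i k. (i, k) \<in> E\<^sup>*" "CARD('n) \<ge> 2"
  obtains x where "x \<bullet> (adjacency_matrix E *v x) = - (x \<bullet> x)" "x \<noteq> 0"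
proof -
  obtain k :: 'n where True by blast
  obtain i where "0 < adjacency_matrix E $ i $ k"
    by (rule irreducible_column_entry_pos[OF irreducible_adjacency_matrix[OF assms(3)] assms(4)])
  then have "(i, k) \<in> E" by (simp add: adjacency_matrix_def split: if_splits)
  moreover from this have "(k, i) \<in> E" "i \<noteq> k" using assms by (auto simp: sym_def irrefl_def)
  moreover have "(i, i) \<notin> E" "(k, k) \<notin> E" using assms by (auto simp: irrefl_def)
  ultimately have *: "adjacency_matrix E $ i $ k = 1" "adjacency_matrix E $ k $ i = 1"
    "adjacency_matrix E $ i $ i = 0" "adjacency_matrix E $ k $ k = 0" "i \<noteq> k"
    by (simp_all add: adjacency_matrix_def)
  define x where "x = axis i (1::real) - axis k 1"
  have "x \<bullet> (adjacency_matrix E *v x) = - 2"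
    using * by (simp add: x_def matrix_vector_mult_diff_distrib matrix_vector_mult_basis column_def
        inner_diff_left inner_axis')
  moreover have "x \<bullet> x = 2"
    using * by (simp add: x_def inner_diff_left inner_diff_right inner_axis_axis)
  moreover from this have "x \<noteq> 0" by auto
  ultimately show thesis using that[of x] by simp
qed

theorem theorem1:
  fixes S :: "real \<Rightarrow> real" and d \<alpha> \<gamma> :: real
    and E :: "('n::finite \<times> 'n) set" and A :: "real ^ 'n ^ 'n"
    and lmax lmin :: complex and u\<^sub>a u\<^sub>d :: real
    and F :: "real \<Rightarrow> real ^ 'n \<Rightarrow> real ^ 'n"
  assumes "CARD('n) \<ge> 2"
    and "saturation S"
    and "d > 0" and "\<alpha> \<ge> 0"
    and "irrefl E"
    and A_def: "A = adjacency_matrix E"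
    and "eigenvalue_max_Re A lmax"
    and "eigenvalue_min_Re A lmin"
    and F_def: "F = opinion_field S d \<alpha> \<gamma> A"
    and ua_def: "u\<^sub>a = d / (\<alpha> + \<gamma> * Re lmax)"
    and ud_def: "u\<^sub>d = d / (\<alpha> + \<gamma> * Re lmin)"
  shows
    "(strongly_connected_graph E \<and> \<gamma> > 0 \<longrightarrow>
        lmax \<in> \<real> \<and> \<alpha> + \<gamma> * Re lmax > 0 \<and>
        (\<forall>u. 0 < u \<and> u < u\<^sub>a \<longrightarrow> locally_exponentially_stable (F u) 0) \<and>
        (\<forall>u>u\<^sub>a. unstable_equilibrium (F u) 0) \<and>
        branches_emerge {0..} F agreement u\<^sub>a (generalized_eigenspace A (Re lmax))) \<and>
     (connected_undirected_graph E \<and> \<gamma> < 0 \<longrightarrow>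
        lmin \<in> \<real> \<and> \<alpha> + \<gamma> * Re lmin > 0 \<and>
        (\<forall>u. 0 < u \<and> u < u\<^sub>d \<longrightarrow> locally_exponentially_stable (F u) 0) \<and>
        (\<forall>u>u\<^sub>d. unstable_equilibrium (F u) 0) \<and>
        branches_emerge {0..} F disagreement u\<^sub>d (generalized_eigenspace A (Re lmin)))"
proof -
  define B where "B = mat \<alpha> + \<gamma> *\<^sub>R A"
  note S = \<open>saturation S\<close> and d = \<open>0 < d\<close>
  have F: "F = saturated_field S d B"
  proof
    have "A $ i $ i = 0" for i
      using \<open>irrefl E\<close> by (simp add: A_def adjacency_matrix_def irrefl_def)
    then show "F u = saturated_field S d B u" for u
      unfolding F_def B_def by (rule opinion_field_eq_saturated_field)
  qed
  have nnA: "0 \<le> A $ i $ k" for i k by (simp add: A_def adjacency_matrix_nonneg)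
  show ?thesis
  proof (intro conjI[of "_ \<longrightarrow> _"] impI)

    \<comment> \<open>Cooperation: the Perron root decides stability, and the branches agree in
      sign\<close>
    assume "strongly_connected_graph E \<and> \<gamma> > 0"
    then have conn: "\<And>i k. (i, k) \<in> E\<^sup>*" and \<gamma>: "0 < \<gamma>"
      by (auto simp: strongly_connected_graph_def)
    have irr: "irreducible_nonneg_matrix A"
      unfolding A_def by (rule irreducible_adjacency_matrix[OF conn])
    obtain v w l where v: "\<And>i. 0 < v $ i" and w: "\<And>i. 0 < w $ i" and l: "0 < l"
      and right: "A *v v = l *\<^sub>R v" and left: "transpose A *v w = l *\<^sub>R w"
      using perron_eigenvectors[OF irr \<open>CARD('n) \<ge> 2\<close>] by blast
    have v0: "v \<noteq> 0" using v by (metis less_irrefl zero_index)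
    have lmax: "lmax = complex_of_real l"
      by (rule perron_eigenvalue_max_Re[OF nnA w left right v0 \<open>eigenvalue_max_Re A lmax\<close>])
    define \<mu> where "\<mu> = \<alpha> + \<gamma> * l"
    have \<mu>: "0 < \<mu>" using \<gamma> l \<open>0 \<le> \<alpha>\<close> by (simp add: \<mu>_def add_nonneg_pos)
    have ua: "u\<^sub>a = d / \<mu>" by (simp add: ua_def lmax \<mu>_def)
    have nnB: "0 \<le> B $ i $ k" for i k
      using nnA[of i k] \<gamma> \<open>0 \<le> \<alpha>\<close> by (simp add: B_def mat_def)
    have eigB: "B *v x = \<mu> *\<^sub>R x \<longleftrightarrow> A *v x = l *\<^sub>R x" for x
      unfolding B_def \<mu>_def using \<gamma> by (intro shifted_matrix_eigenvector_iff) simp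
    have leftB: "transpose B *v w = \<mu> *\<^sub>R w"
      unfolding B_def \<mu>_def transpose_shifted_matrix
      using \<gamma> left by (subst shifted_matrix_eigenvector_iff) auto
    have rightB: "B *v v = \<mu> *\<^sub>R v" using right eigB by simp
    have W: "generalized_eigenspace A (Re lmax) = {x. B *v x = \<mu> *\<^sub>R x}"
      using perron_generalized_eigenspace[OF irr v w right left] by (simp add: lmax eigB)
    show "lmax \<in> \<real> \<and> \<alpha> + \<gamma> * Re lmax > 0 \<and>
        (\<forall>u. 0 < u \<and> u < u\<^sub>a \<longrightarrow> locally_exponentially_stable (F u) 0) \<and>
        (\<forall>u>u\<^sub>a. unstable_equilibrium (F u) 0) \<and>
        branches_emerge {0..} F agreement u\<^sub>a (generalized_eigenspace A (Re lmax))"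
    proof (intro conjI allI impI)
      show "lmax \<in> \<real>" by (simp add: lmax)
      show "\<alpha> + \<gamma> * Re lmax > 0" using \<mu> by (simp add: lmax \<mu>_def)
      show "locally_exponentially_stable (F u) 0" if "0 < u \<and> u < u\<^sub>a" for u
        unfolding F using that \<mu>
        by (intro saturated_field_stable_perron[OF S nnB v w rightB leftB])
          (auto simp: ua pos_less_divide_eq)
      show "unstable_equilibrium (F u) 0" if "u\<^sub>a < u" for u
      proof -
        have "0 < u\<^sub>a" using d \<mu> by (simp add: ua)
        then have "0 < u" using that by simp
        then show ?thesis
          unfolding F using that \<mu>
          by (intro saturated_field_unstable_perron[OF S nnB w leftB \<mu> d])
            (auto simp: ua pos_divide_less_eq)
      qed
      show "branches_emerge {0..} F agreement u\<^sub>a (generalized_eigenspace A (Re lmax))"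
        unfolding F ua W
      proof (rule branches_emerge_if_open_scaling_property[OF _ agreement_scaleR])
        show "steady_state_bifurcation {0..} (saturated_field S d B) (d / \<mu>) {x. B *v x = \<mu> *\<^sub>R x}"
          using equilibria_near_bifurcation_perron[OF S nnB v rightB \<mu> d]
          by (rule steady_state_bifurcation_saturated_field[OF S d \<mu> v0 rightB])
        fix z assume "z \<in> {x. B *v x = \<mu> *\<^sub>R x}" and z0: "z \<noteq> 0"
        then have "A *v z = l *\<^sub>R z" using eigB by simp
        \<comment> \<open>The kernel is the line spanned by the positive vector \<open>v\<close>, so
          the entries of a nonzero element share one strict sign.\<close>
        then obtain a where a: "z = a *\<^sub>R v" by (rule perron_eigenspace[OF irr v right])
        moreover from a have "a \<noteq> 0" using z0 by auto
        ultimately have "agreement z" using v by (auto simp: agreement_def sgn_mult less_imp_neq[symmetric])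
        then show "eventually agreement (nhds z)" by (rule eventually_agreement)
      qed
    qed
  next

    \<comment> \<open>Competition: the smallest eigenvalue decides stability, and the branches
      disagree in sign\<close>
    assume "connected_undirected_graph E \<and> \<gamma> < 0"
    then have conn: "\<And>i k. (i, k) \<in> E\<^sup>*" and "sym E" and \<gamma>: "\<gamma> < 0"
      by (auto simp: connected_undirected_graph_def)
    have symA: "transpose A = A"
      unfolding A_def by (rule transpose_adjacency_matrix[OF \<open>sym E\<close>])
    then have symB: "transpose B = B" by (simp add: B_def transpose_shifted_matrix)
    define l where "l = Re lmin"
    obtain v where real: "lmin \<in> \<real>" and v0: "v \<noteq> 0" and eig: "A *v v = l *\<^sub>R v"
      and low: "\<And>x. l * (x \<bullet> x) \<le> x \<bullet> (A *v x)"
      using symmetric_matrix_eigenvalue_min_Re[OF symA \<open>eigenvalue_min_Re A lmin\<close>]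
      unfolding l_def by blast
    have l: "l < 0"
    proof -
      obtain x where x: "x \<bullet> (A *v x) = - (x \<bullet> x)" "x \<noteq> 0"
        using adjacency_matrix_negative_form[OF \<open>irrefl E\<close> \<open>sym E\<close> conn \<open>CARD('n) \<ge> 2\<close>]
        unfolding A_def by blast
      then have pos: "0 < x \<bullet> x" by simp
      then have "l * (x \<bullet> x) < 0 * (x \<bullet> x)" using low[of x] x(1) by linarith
      then show ?thesis using pos by (simp only: mult_less_cancel_right_pos)
    qed
    define \<mu> where "\<mu> = \<alpha> + \<gamma> * l"
    have \<mu>: "0 < \<mu>" using \<gamma> l \<open>0 \<le> \<alpha>\<close> by (simp add: \<mu>_def add_nonneg_pos mult_neg_neg)
    have ud: "u\<^sub>d = d / \<mu>" by (simp add: ud_def l_def \<mu>_def)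
    have eigB: "B *v x = \<mu> *\<^sub>R x \<longleftrightarrow> A *v x = l *\<^sub>R x" for x
      unfolding B_def \<mu>_def using \<gamma> by (intro shifted_matrix_eigenvector_iff) simp
    have vB: "B *v v = \<mu> *\<^sub>R v" using eig eigB by simp
    \<comment> \<open>Multiplication by \<open>\<gamma> < 0\<close> reverses the Rayleigh bound: the
      lower bound for \<open>A\<close> at its smallest eigenvalue becomes an upper bound for
      \<open>B\<close>.\<close>
    have upper: "x \<bullet> (B *v x) \<le> \<mu> * (x \<bullet> x)" for x
    proof -
      have "x \<bullet> (B *v x) = \<alpha> * (x \<bullet> x) + \<gamma> * (x \<bullet> (A *v x))"
        unfolding B_def shifted_matrix_vector_mult by (simp add: inner_add_right)
      also have "\<dots> \<le> \<alpha> * (x \<bullet> x) + \<gamma> * (l * (x \<bullet> x))"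
        using \<gamma> by (intro add_left_mono mult_left_mono_neg low) simp
      finally show ?thesis by (simp add: \<mu>_def algebra_simps)
    qed
    have W: "generalized_eigenspace A (Re lmin) = {x. B *v x = \<mu> *\<^sub>R x}"
      using symmetric_matrix_generalized_eigenspace[OF symA] by (simp add: eigB l_def)
    show "lmin \<in> \<real> \<and> \<alpha> + \<gamma> * Re lmin > 0 \<and>
        (\<forall>u. 0 < u \<and> u < u\<^sub>d \<longrightarrow> locally_exponentially_stable (F u) 0) \<and>
        (\<forall>u>u\<^sub>d. unstable_equilibrium (F u) 0) \<and>
        branches_emerge {0..} F disagreement u\<^sub>d (generalized_eigenspace A (Re lmin))"
    proof (intro conjI allI impI)
      show "lmin \<in> \<real>" by (rule real)
      show "\<alpha> + \<gamma> * Re lmin > 0" using \<mu> by (simp add: l_def \<mu>_def)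
      show "locally_exponentially_stable (F u) 0" if "0 < u \<and> u < u\<^sub>d" for u
        unfolding F using that \<mu>
        by (intro saturated_field_stable_symmetric[OF S upper]) (auto simp: ud pos_less_divide_eq)
      show "unstable_equilibrium (F u) 0" if "u\<^sub>d < u" for u
      proof -
        have "0 < u\<^sub>d" using d \<mu> by (simp add: ud)
        then have "0 < u" using that by simp
        then show ?thesis
          unfolding F using that \<mu>
          by (intro saturated_field_unstable_symmetric[OF S symB v0 vB d])
            (auto simp: ud pos_divide_less_eq)
      qed
      show "branches_emerge {0..} F disagreement u\<^sub>d (generalized_eigenspace A (Re lmin))"
        unfolding F ud W
      proof (rule branches_emerge_if_open_scaling_property[OF _ disagreement_scaleR])
        show "steady_state_bifurcation {0..} (saturated_field S d B) (d / \<mu>) {x. B *v x = \<mu> *\<^sub>R x}"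
          using equilibria_near_bifurcation_symmetric[OF S symB upper v0 vB \<mu> d]
          by (rule steady_state_bifurcation_saturated_field[OF S d \<mu> v0 vB])
        fix z assume "z \<in> {x. B *v x = \<mu> *\<^sub>R x}" and z0: "z \<noteq> 0"
        then have z: "A *v z = l *\<^sub>R z" using eigB by simp
        obtain i where i: "0 < z $ i"
          by (rule nonneg_matrix_negative_eigenvector_pos_entry[OF nnA z z0 l])
        have mz: "A *v (- z) = l *\<^sub>R (- z)"
          using z matrix_vector_mult_diff_distrib[of A 0 z] by simp
        obtain k where "0 < (- z) $ k"
          using nonneg_matrix_negative_eigenvector_pos_entry[OF nnA mz _ l] z0 by auto
        then show "eventually disagreement (nhds z)"
          using eventually_disagreement[OF i] by simp
      qed
    qed
  qed
qed

end
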